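(* Let $f:\mathbb{R}^d\to\mathbb{R}$ be convex with nonempty set of minimizers $X_\star$, suppose an $(\alpha,\beta)$-convex smoothing family of $f$ is known ($\alpha,\beta>0$; defined in the context), and suppose for some $\mu>0$ and $p\ge2$ that $f(x)-f_\star\ge\mu\operatorname{dist}(x,X_\star)^p$ for all $x$ with $f(x)\le f(x^{(0)})$. Let $\Delta_0=f(x^{(0)})-f_\star$ and $0<\epsilon<\Delta_0$. Run the Dynamic Restarting Scheme (described in the context) from $x^{(0)}$ with $\mathtt{fom}(\epsilon)$ equal to the smoothing method (described in the context), $N_0=1$, and $\epsilon_k=\frac{\epsilon}{2e}\exp(c^k)$ for any $c\in(1,2-\frac1p)$. Then the scheme computes an $\epsilon$-optimal solution with iteration complexity and oracle complexity respectively at most $$\mathcal{O}\left(\frac{\sqrt{\alpha\beta}}{\mu^{1/p}}\cdot\frac1{\epsilon^{1-\frac1p}}\right)\quad\text{and}\quad\mathcal{O}\left(\frac{\sqrt{\alpha\beta}}{\mu^{1/p}}\cdot\frac1{\epsilon^{1-\frac1p}}\cdot\log\log\left(\frac{\Delta_0}\epsilon\right)\right).$$ No other choice of $\{\epsilon_k\}$ asymptotically improves these rates in the bound $$B(\{\epsilon_k\})=\sum_{k=0}^{m-1}\left(1+\frac{2\epsilon_{k+1}}{\epsilon_k}\right)K_{\mathtt{dec}}\left(\epsilon_k,2\epsilon_k,(2\epsilon_k/\mu)^{1/p}\right),\qquad K_{\mathtt{dec}}(\epsilon,\delta,D)=\sqrt{\frac{16\alpha\beta D^2}{\epsilon(\delta-\frac32\epsilon)}},$$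 even in the $\log\log$ factor: over all strictly increasing positive sequences $\{\epsilon_k\}_{k\ge0}$ with $\epsilon_0\le\epsilon/2$ and $\epsilon_k\to\infty$, the infimum of $B(\{\epsilon_k\})$ (iteration bound) and the infimum of $(\hat m+1)B(\{\epsilon_k\})$ (oracle bound) are, respectively, at least of the order ($\Omega$) of the two displayed rates, where $m=\inf\{k:\epsilon_k\ge\Delta_0/2\}$ and $\hat m=\inf\{k:\epsilon_k>\Delta_0\}$.
   Context: Notation: $f_\star=\min f$, $X_\star=\operatorname{argmin} f$, $\operatorname{dist}(y,X_\star)=\inf_{x\in X_\star}\|y-x\|_2$. $x$ is $\epsilon$-optimal if $f(x)-f_\star\le\epsilon$. Asymptotic notations are with respect to $\epsilon\to0$ ($p$ and $c$ fixed, dependence on $\alpha,\beta,\mu,\Delta_0$ as displayed). Iteration complexity is the number of rounds of the scheme until some $\overline x^{(t)}$ (defined below) is $\epsilon$-optimal; oracle complexity is the total number of $\mathtt{fom}$ iterations performed over all processes up to then. An $(\alpha,\beta)$-convex smoothing family of $f$ is a collection of functions $f_\eta$, $\eta>0$, each smooth and convex, with $\|\nabla f_\eta(x)-\nabla f_\eta(y)\|_2\le\frac\alpha\eta\|x-y\|_2$ and $f(x)\le f_\eta(x)\le f(x)+\beta\eta$ for all $x,y$. Accelerated method for an $L$-smooth convex $h$. From initial point $x^{(0)}$: $\theta^{(0)}=1$, $y^{(0)}=x^{(0)}$, and iterate $x^{(k+1)}=y^{(k)}-\frac1L\nabla h(y^{(k)})$, $\theta^{(k+1)}=\frac{1+\sqrt{1+4(\theta^{(k)})^2}}2$,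 $y^{(k+1)}=x^{(k+1)}+\frac{\theta^{(k)}-1}{\theta^{(k+1)}}(x^{(k+1)}-x^{(k)})$. Smoothing method: $\mathtt{fom}(\epsilon)$ is the accelerated method applied to $h=f_\eta$ with $\eta=\frac\epsilon{4\beta}$ (and $L=\alpha/\eta$). Dynamic Restarting Scheme. Input: $x^{(0)}$, strictly increasing positive targets $\{\epsilon_k\}_{k\ge0}$ with $\epsilon_k\to\infty$, $\mathtt{fom}$, and an initial process count $N_0\ge1$. Process $P_k$ runs $\mathtt{fom}(\epsilon_k)$ and stores a reference point; its task is to obtain a point $\overline x$ with $f(\overline x)\le f(\text{reference point of }P_k)-\epsilon_k$. Round $0$: set $\overline x^{(0)}=x^{(0)}$ and launch $P_0,\dots,P_{N_0-1}$, each with initial point and reference point $x^{(0)}$. Round $t=1,2,\dots$: (Step 1) every process currently in the scheme runs one iteration; let $\overline x^{(t)}$ be an iterate with minimum objective value (of $f$) among all new iterates of this round. (Step 2) For each process $P_k$ that was in the scheme at the beginning of round $t$: if $\overline x^{(t)}$ accomplishes the task of $P_k$, then $P_k$ is restarted at $\overline x^{(t)}$ (its memory is cleared, it then behaves as $\mathtt{fom}(\epsilon_k)$ started from $\overline x^{(t)}$, and its reference point becomes $\overline x^{(t)}$); if moreover $P_k$ is the highest-indexed process entering round $t$, a new process $P_{k+1}$ is launched with initial point and reference point $\overline x^{(t)}$ (its first iteration occurs in round $t+1$). Otherwise $P_k$ continues unchanged. *)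

theory Defs
  imports "HOL-Analysis.Analysis"
begin

text \<open>
  Euclidean space is represented by a finite-dimensional subspace \<open>S = span B\<close>, \<open>B\<close> finite, of an
  arbitrary real inner product space \<open>'a\<close>, rather than by a type such as \<open>real ^ 'n\<close>.  A constant
  asserted to exist in a theorem can depend on the types of that theorem, but it precedes the
  quantification over \<open>S\<close>; so for infinite-dimensional \<open>'a\<close> (which has subspaces of every finite
  dimension) the constant does not depend on the dimension.  \<open>S = UNIV\<close> for \<open>'a = real ^ 'n\<close> is
  the usual coordinate space.  Functions have type \<open>'a \<Rightarrow> real\<close>, but only their values on \<open>S\<close> are
  used.
\<close>


section \<open>Minimization, gradients and smoothing\<close>

definition min_value :: "'a set \<Rightarrow> ('a \<Rightarrow> real) \<Rightarrow> real" where
  "min_value S f = (INF x\<in>S. f x)"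

definition minimizers :: "'a set \<Rightarrow> ('a \<Rightarrow> real) \<Rightarrow> 'a set" where
  "minimizers S f = {x. is_arg_min f (\<lambda>y. y \<in> S) x}"

definition eps_optimal :: "'a set \<Rightarrow> ('a \<Rightarrow> real) \<Rightarrow> real \<Rightarrow> 'a \<Rightarrow> bool" where
  "eps_optimal S f \<epsilon> x \<longleftrightarrow> f x - min_value S f \<le> \<epsilon>"

definition has_gradient :: "'a::real_inner set \<Rightarrow> ('a \<Rightarrow> real) \<Rightarrow> 'a \<Rightarrow> 'a \<Rightarrow> bool" where
  "has_gradient S h x g \<longleftrightarrow> g \<in> S \<and> (h has_derivative (\<lambda>v. inner g v)) (at x within S)"

(* On a subspace S there is at most one such g, since g is required to lie in S. *)
definition gradient :: "'a::real_inner set \<Rightarrow> ('a \<Rightarrow> real) \<Rightarrow> 'a \<Rightarrow> 'a" where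
  "gradient S h x = (THE g. has_gradient S h x g)"

definition smoothing_family ::
    "'a::real_inner set \<Rightarrow> ('a \<Rightarrow> real) \<Rightarrow> real \<Rightarrow> real \<Rightarrow> (real \<Rightarrow> 'a \<Rightarrow> real) \<Rightarrow> bool" where
  "smoothing_family S f \<alpha> \<beta> F \<longleftrightarrow>
     (\<forall>\<eta>>0.
        convex_on S (F \<eta>) \<and>
        (\<forall>x\<in>S. \<exists>g. has_gradient S (F \<eta>) x g) \<and>
        (\<forall>x\<in>S. \<forall>y\<in>S. norm (gradient S (F \<eta>) x - gradient S (F \<eta>) y) \<le> \<alpha> / \<eta> * norm (x - y)) \<and>
        (\<forall>x\<in>S. f x \<le> F \<eta> x \<and> F \<eta> x \<le> f x + \<beta> * \<eta>))"


section \<open>The accelerated method and the smoothing method\<close>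

(* The fields are x, y and theta, respectively, at the current iteration. *)
record 'a accel_state =
  iterate :: 'a
  extrapolated :: 'a
  theta :: real

definition accel_init :: "'a \<Rightarrow> 'a accel_state" where
  "accel_init x = \<lparr>iterate = x, extrapolated = x, theta = 1\<rparr>"

definition accel_step ::
    "'a::real_inner set \<Rightarrow> ('a \<Rightarrow> real) \<Rightarrow> real \<Rightarrow> 'a accel_state \<Rightarrow> 'a accel_state" where
  "accel_step S h L s =
     (let x' = extrapolated s - (1 / L) *\<^sub>R gradient S h (extrapolated s);
          \<theta>' = (1 + sqrt (1 + 4 * (theta s)\<^sup>2)) / 2
      in \<lparr>iterate = x',
          extrapolated = x' + ((theta s - 1) / \<theta>') *\<^sub>R (x' - iterate s),
          theta = \<theta>'\<rparr>)"

definition smoothing_step ::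
    "'a::real_inner set \<Rightarrow> real \<Rightarrow> real \<Rightarrow> (real \<Rightarrow> 'a \<Rightarrow> real) \<Rightarrow> real \<Rightarrow> 'a accel_state \<Rightarrow> 'a accel_state" where
  "smoothing_step S \<alpha> \<beta> F \<epsilon> = (let \<eta> = \<epsilon> / (4 * \<beta>) in accel_step S (F \<eta>) (\<alpha> / \<eta>))"


section \<open>The Dynamic Restarting Scheme\<close>

(* State at the end of a round.  The processes in the scheme are those with index below n_procs;
   the values of memory and reference at larger indices are irrelevant.  best is the best new
   iterate of the round, not the best point found so far. *)
record 'a scheme_state =
  best :: 'a
  n_procs :: nat
  memory :: "nat \<Rightarrow> 'a accel_state"
  reference :: "nat \<Rightarrow> 'a"

definition scheme_init :: "nat \<Rightarrow> 'a \<Rightarrow> 'a scheme_state \<Rightarrow> bool" where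
  "scheme_init N0 x0 s \<longleftrightarrow>
     best s = x0 \<and> n_procs s = N0 \<and>
     (\<forall>k<N0. memory s k = accel_init x0 \<and> reference s k = x0)"

(* step e is one iteration of fom(e).  A round is a relation because the minimum over the new
   iterates may be attained by several of them, and any of these may become the best one. *)
definition scheme_round ::
    "('a \<Rightarrow> real) \<Rightarrow> (real \<Rightarrow> 'a accel_state \<Rightarrow> 'a accel_state) \<Rightarrow> (nat \<Rightarrow> real)
     \<Rightarrow> 'a scheme_state \<Rightarrow> 'a scheme_state \<Rightarrow> bool" where
  "scheme_round f step e s s' \<longleftrightarrow>
     (let N = n_procs s;
          new = (\<lambda>k. step (e k) (memory s k));
          z = best s';
          accomplished = (\<lambda>k. f z \<le> f (reference s k) - e k)
      in is_arg_min f (\<lambda>y. y \<in> (\<lambda>k. iterate (new k)) ` {..<N}) z \<and>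
         (\<forall>k<N. if accomplished k
                then memory s' k = accel_init z \<and> reference s' k = z
                else memory s' k = new k \<and> reference s' k = reference s k) \<and>
         (if accomplished (N - 1)
          then n_procs s' = N + 1 \<and> memory s' N = accel_init z \<and> reference s' N = z
          else n_procs s' = N))"

(* \<sigma> t is the state at the end of round t; the run is not stopped at an epsilon-optimal point. *)
definition scheme_run ::
    "('a \<Rightarrow> real) \<Rightarrow> (real \<Rightarrow> 'a accel_state \<Rightarrow> 'a accel_state) \<Rightarrow> (nat \<Rightarrow> real) \<Rightarrow> nat \<Rightarrow> 'a
     \<Rightarrow> (nat \<Rightarrow> 'a scheme_state) \<Rightarrow> bool" where
  "scheme_run f step e N0 x0 \<sigma> \<longleftrightarrow>
     scheme_init N0 x0 (\<sigma> 0) \<and> (\<forall>t. scheme_round f step e (\<sigma> t) (\<sigma> (Suc t)))"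

(* Meaningful only for runs that reach an epsilon-optimal point. *)
definition iteration_complexity ::
    "'a set \<Rightarrow> ('a \<Rightarrow> real) \<Rightarrow> real \<Rightarrow> (nat \<Rightarrow> 'a scheme_state) \<Rightarrow> nat" where
  "iteration_complexity S f \<epsilon> \<sigma> = (LEAST t. eps_optimal S f \<epsilon> (best (\<sigma> t)))"

(* In round t + 1 each of the n_procs (\<sigma> t) processes present performs one iteration. *)
definition oracle_complexity ::
    "'a set \<Rightarrow> ('a \<Rightarrow> real) \<Rightarrow> real \<Rightarrow> (nat \<Rightarrow> 'a scheme_state) \<Rightarrow> nat" where
  "oracle_complexity S f \<epsilon> \<sigma> = (\<Sum>t<iteration_complexity S f \<epsilon> \<sigma>. n_procs (\<sigma> t))"


section \<open>Rates and the bound to be optimized over target sequences\<close>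

definition iteration_rate :: "real \<Rightarrow> real \<Rightarrow> real \<Rightarrow> real \<Rightarrow> real \<Rightarrow> real" where
  "iteration_rate p \<alpha> \<beta> \<mu> \<epsilon> = sqrt (\<alpha> * \<beta>) / \<mu> powr (1 / p) * (1 / \<epsilon> powr (1 - 1 / p))"

definition oracle_rate :: "real \<Rightarrow> real \<Rightarrow> real \<Rightarrow> real \<Rightarrow> real \<Rightarrow> real \<Rightarrow> real" where
  "oracle_rate p \<alpha> \<beta> \<mu> \<Delta>\<^sub>0 \<epsilon> = iteration_rate p \<alpha> \<beta> \<mu> \<epsilon> * ln (ln (\<Delta>\<^sub>0 / \<epsilon>))"

definition K_dec :: "real \<Rightarrow> real \<Rightarrow> real \<Rightarrow> real \<Rightarrow> real \<Rightarrow> real" where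
  "K_dec \<alpha> \<beta> \<epsilon> \<delta> D = sqrt (16 * \<alpha> * \<beta> * D\<^sup>2 / (\<epsilon> * (\<delta> - 3 / 2 * \<epsilon>)))"

definition stage_count :: "real \<Rightarrow> (nat \<Rightarrow> real) \<Rightarrow> nat" where
  "stage_count \<Delta>\<^sub>0 e = Inf {k. e k \<ge> \<Delta>\<^sub>0 / 2}"

definition top_index :: "real \<Rightarrow> (nat \<Rightarrow> real) \<Rightarrow> nat" where
  "top_index \<Delta>\<^sub>0 e = Inf {k. e k > \<Delta>\<^sub>0}"

definition B_bound :: "real \<Rightarrow> real \<Rightarrow> real \<Rightarrow> real \<Rightarrow> real \<Rightarrow> (nat \<Rightarrow> real) \<Rightarrow> real" where
  "B_bound p \<alpha> \<beta> \<mu> \<Delta>\<^sub>0 e =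
     (\<Sum>k<stage_count \<Delta>\<^sub>0 e.
        (1 + 2 * e (k + 1) / e k) * K_dec \<alpha> \<beta> (e k) (2 * e k) ((2 * e k / \<mu>) powr (1 / p)))"

definition target_sequences :: "real \<Rightarrow> (nat \<Rightarrow> real) set" where
  "target_sequences \<epsilon> =
     {e. strict_mono e \<and> (\<forall>k. e k > 0) \<and> e 0 \<le> \<epsilon> / 2 \<and> filterlim e at_top sequentially}"

end

theory Submission
  imports Defs "HOL-Real_Asymp.Real_Asymp"
begin

text \<open>
  Upper bounds: Nesterov's energy argument shows that a process with target \<open>e k\<close> whose reference
  point has gap at least \<open>2 * e k\<close> restarts within \<open>T k = O(R * e k powr - (1 - 1 / p))\<close> rounds, where
  \<open>R = sqrt (\<alpha> * \<beta>) / \<mu> powr (1 / p)\<close>.  Once the gap of process \<open>k + 1\<close> is below \<open>2 * e (k + 1)\<close>, that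
  of process \<open>k\<close> is below \<open>2 * e (k + 1) + e k\<close>, so \<open>2 * e (k + 1) / e k\<close> further restarts bring it
  below \<open>2 * e k\<close>; going down to \<open>k = 0\<close> gives \<open>\<epsilon>\<close>-optimality after \<open>O(\<Sum>k. e (k + 1) / e k * T k)\<close>
  rounds, a sum that converges because \<open>c < 2 - 1 / p\<close>.

  Lower bounds: the first term of the sum already has the order of the iteration rate, and a small sum
  forces \<open>ln (e k / \<epsilon>)\<close> to grow at most geometrically, hence many stages.
\<close>

section \<open>The accelerated method\<close>

text \<open>The whole line stays in \<open>S\<close>, so a derivative within \<open>S\<close>, which
  may have empty interior, restricts to an ordinary one-variable derivative.\<close>

lemma has_gradient_along_line:
  assumes "subspace S" "x \<in> S" "v \<in> S" "has_gradient S h (x + t *\<^sub>R v) g"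
  shows "((\<lambda>s. h (x + s *\<^sub>R v)) has_real_derivative inner g v) (at t)"
proof -
  have "(h has_derivative inner g) (at (x + t *\<^sub>R v) within range (\<lambda>s. x + s *\<^sub>R v))"
    using assms by (auto simp: has_gradient_def subspace_add subspace_scale
        intro: has_derivative_subset)
  moreover have "((\<lambda>s. x + s *\<^sub>R v) has_derivative (\<lambda>s. s *\<^sub>R v)) (at t)"
    by (auto intro!: derivative_eq_intros)
  ultimately have "(h \<circ> (\<lambda>s. x + s *\<^sub>R v) has_derivative inner g \<circ> (\<lambda>s. s *\<^sub>R v)) (at t)"
    by (rule diff_chain_within[rotated])
  then show ?thesis
    by (simp add: has_field_derivative_def o_def mult_commute_abs)
qed

text \<open>The difference of two gradients is itself a direction in \<open>S\<close>, and comparing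
  the derivatives along it shows that its norm vanishes. This makes the \<open>THE\<close> in
  \<open>gradient\<close> meaningful.\<close>

lemma has_gradient_unique:
  assumes "subspace S" "x \<in> S" "has_gradient S h x g" "has_gradient S h x g'"
  shows "g = g'"
proof -
  have v: "g - g' \<in> S"
    using assms by (auto simp: has_gradient_def subspace_diff)
  have "inner g (g - g') = inner g' (g - g')"
    using assms v
    by (intro DERIV_unique[where f = "\<lambda>s. h (x + s *\<^sub>R (g - g'))" and x = 0]
        has_gradient_along_line[of S]) auto
  then have "inner (g - g') (g - g') = 0"
    by (simp add: inner_diff_left)
  then show ?thesis by simp
qed

lemma has_gradient_gradient:
  assumes "subspace S" "x \<in> S" "\<exists>g. has_gradient S h x g"
  shows "has_gradient S h x (gradient S h x)"
  unfolding gradient_def using assms has_gradient_unique by (blast intro: theI')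

section \<open>Smooth convex functions on a subspace and Nesterov's rate\<close>

locale smooth_convex =
  fixes S :: "'a::real_inner set" and h :: "'a \<Rightarrow> real" and L :: real
  assumes subspace: "subspace S"
    and convex: "convex_on S h"
    and differentiable: "x \<in> S \<Longrightarrow> \<exists>g. has_gradient S h x g"
    and lipschitz: "x \<in> S \<Longrightarrow> y \<in> S \<Longrightarrow>
      norm (gradient S h x - gradient S h y) \<le> L * norm (x - y)"
    and L_pos: "0 < L"
begin

lemma line_in: "x \<in> S \<Longrightarrow> v \<in> S \<Longrightarrow> x + t *\<^sub>R v \<in> S"
  by (simp add: subspace subspace_add subspace_scale)

lemma gradient_in: "x \<in> S \<Longrightarrow> gradient S h x \<in> S"
  using has_gradient_gradient[OF subspace _ differentiable] by (auto simp: has_gradient_def)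

lemma deriv_along_line:
  assumes "x \<in> S" "v \<in> S"
  shows "((\<lambda>s. h (x + s *\<^sub>R v)) has_real_derivative inner (gradient S h (x + t *\<^sub>R v)) v) (at t)"
  by (rule has_gradient_along_line[OF subspace assms])
    (intro has_gradient_gradient[OF subspace] differentiable line_in assms)

lemma above_tangent:
  assumes "x \<in> S" "y \<in> S"
  shows "h x + inner (gradient S h x) (y - x) \<le> h y"
proof -
  define \<phi> where "\<phi> t = h (x + t *\<^sub>R (y - x))" for t
  have v: "y - x \<in> S" using assms subspace by (simp add: subspace_diff)
  have "convex_on UNIV \<phi>"
  proof (rule convex_onI)
    fix t a b :: real assume "0 < t" "t < 1"
    have "x + ((1 - t) *\<^sub>R a + t *\<^sub>R b) *\<^sub>R (y - x)
        = (1 - t) *\<^sub>R (x + a *\<^sub>R (y - x)) + t *\<^sub>R (x + b *\<^sub>R (y - x))"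
      by (simp add: algebra_simps)
    then show "\<phi> ((1 - t) *\<^sub>R a + t *\<^sub>R b) \<le> (1 - t) * \<phi> a + t * \<phi> b"
      unfolding \<phi>_def using convex_onD[OF convex, of t] \<open>0 < t\<close> \<open>t < 1\<close> assms v line_in by simp
  qed simp
  then have "\<phi> 1 - \<phi> 0 \<ge> inner (gradient S h x) (y - x) * (1 - 0)"
    using deriv_along_line[OF assms(1) v, of 0]
    by (intro convex_on_imp_above_tangent[where A = UNIV]) (auto simp: \<phi>_def[abs_def])
  then show ?thesis by (simp add: \<phi>_def)
qed

text \<open>Descent lemma: along the segment, \<open>h\<close> minus its quadratic model has
  nonpositive derivative, by Cauchy-Schwarz and the Lipschitz bound.\<close>

lemma below_quadratic:
  assumes "x \<in> S" "y \<in> S"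
  shows "h y \<le> h x + inner (gradient S h x) (y - x) + L / 2 * (norm (y - x))\<^sup>2"
proof -
  define v where "v = y - x"
  have v: "v \<in> S" using assms subspace by (simp add: v_def subspace_diff)
  define \<psi> where
    "\<psi> t = h (x + t *\<^sub>R v) - t * inner (gradient S h x) v - L / 2 * t\<^sup>2 * (norm v)\<^sup>2" for t
  have "\<psi> 1 \<le> \<psi> 0"
  proof (rule DERIV_nonpos_imp_nonincreasing[where f = \<psi> and a = 0 and b = 1])
    fix t :: real assume "0 \<le> t" "t \<le> 1"
    let ?D = "inner (gradient S h (x + t *\<^sub>R v)) v - inner (gradient S h x) v - L * t * (norm v)\<^sup>2"
    have "(\<psi> has_real_derivative ?D) (at t)"
      unfolding \<psi>_def by (auto intro!: derivative_eq_intros deriv_along_line assms v)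
    moreover have "?D \<le> 0"
    proof -
      have "inner (gradient S h (x + t *\<^sub>R v) - gradient S h x) v
          \<le> norm (gradient S h (x + t *\<^sub>R v) - gradient S h x) * norm v"
        by (rule norm_cauchy_schwarz)
      also have "\<dots> \<le> (L * norm (t *\<^sub>R v)) * norm v"
        using lipschitz[OF line_in[OF assms(1) v] assms(1), of t]
        by (intro mult_right_mono) auto
      finally show ?thesis
        using \<open>0 \<le> t\<close> by (simp add: inner_diff_left power2_eq_square mult.assoc)
    qed
    ultimately show "\<exists>D. (\<psi> has_real_derivative D) (at t) \<and> D \<le> 0" by blast
  qed simp
  then show ?thesis by (simp add: \<psi>_def v_def)
qed

text \<open>Adds the quadratic upper bound at \<open>y\<close> to the tangent inequality towards
  \<open>u\<close>, with the gradient expressed through the step \<open>x' - y\<close>. It is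
  applied with \<open>u\<close> the previous iterate and with \<open>u\<close> the comparison
  point.\<close>

lemma gradient_step:
  fixes y u
  defines "x' \<equiv> y - (1 / L) *\<^sub>R gradient S h y"
  assumes "y \<in> S" "u \<in> S"
  shows "h x' + L / 2 * (norm (x' - y))\<^sup>2 + L * inner (y - u) (x' - y) \<le> h u"
proof -
  have g: "gradient S h y = L *\<^sub>R (y - x')"
    using L_pos by (simp add: x'_def)
  have "x' \<in> S"
    using assms subspace gradient_in by (simp add: x'_def subspace_diff subspace_scale)
  then have "h x' \<le> h y + inner (gradient S h y) (x' - y) + L / 2 * (norm (x' - y))\<^sup>2"
    using below_quadratic assms by blast
  moreover have "h y + inner (gradient S h y) (u - y) \<le> h u"
    using above_tangent assms by blast
  moreover have "inner (gradient S h y) (x' - y) = - L * (norm (x' - y))\<^sup>2"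
    unfolding g by (simp add: power2_norm_eq_inner algebra_simps inner_commute)
  moreover have "inner (gradient S h y) (u - y) = L * inner (y - u) (x' - y)"
    unfolding g by (simp add: algebra_simps inner_commute)
  ultimately show ?thesis by linarith
qed

text \<open>Lyapunov function of the accelerated method. After a step the weight of the gap is the
  square of the preceding \<open>theta\<close>; for \<open>theta = 1\<close> it vanishes, so
  initially only the distance term remains.\<close>

definition energy :: "'a \<Rightarrow> 'a accel_state \<Rightarrow> real" where
  "energy u s = ((theta s)\<^sup>2 - theta s) * (h (iterate s) - h u) +
     L / 2 * (norm (theta s *\<^sub>R extrapolated s - (theta s - 1) *\<^sub>R iterate s - u))\<^sup>2"

lemma accel_step_in:
  assumes "iterate s \<in> S" "extrapolated s \<in> S"
  shows "iterate (accel_step S h L s) \<in> S" "extrapolated (accel_step S h L s) \<in> S"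
  using assms subspace gradient_in
  by (simp_all add: accel_step_def Let_def subspace_diff subspace_add subspace_scale)

lemma theta_accel_step:
  assumes "1 \<le> theta s"
  defines "\<theta>' \<equiv> theta (accel_step S h L s)"
  shows "\<theta>'\<^sup>2 - \<theta>' = (theta s)\<^sup>2" "theta s + 1 / 2 \<le> \<theta>'"
proof -
  have \<theta>': "\<theta>' = (1 + sqrt (1 + 4 * (theta s)\<^sup>2)) / 2"
    by (simp add: \<theta>'_def accel_step_def Let_def)
  have "(2 * \<theta>' - 1)\<^sup>2 = 1 + 4 * (theta s)\<^sup>2"
    by (simp add: \<theta>' add_divide_distrib)
  then show "\<theta>'\<^sup>2 - \<theta>' = (theta s)\<^sup>2"
    by (simp add: power2_eq_square algebra_simps)
  have "2 * theta s \<le> sqrt (1 + 4 * (theta s)\<^sup>2)"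
    by (rule real_le_rsqrt) (simp add: power_mult_distrib)
  then show "theta s + 1 / 2 \<le> \<theta>'"
    unfolding \<theta>' by simp
qed

text \<open>The comparison point \<open>u\<close> need not minimize \<open>h\<close>: it will be a minimizer of the function
  of which \<open>h\<close> is a smoothing.\<close>

lemma energy_accel_step:
  assumes "iterate s \<in> S" "extrapolated s \<in> S" "1 \<le> theta s" "u \<in> S"
  shows "energy u (accel_step S h L s) \<le> energy u s"
proof -
  define x y \<theta> where "x = iterate s" and "y = extrapolated s" and "\<theta> = theta s"
  define s' where "s' = accel_step S h L s"
  define x' \<theta>' where "x' = iterate s'" and "\<theta>' = theta s'"
  define w d where "w = \<theta> *\<^sub>R y - (\<theta> - 1) *\<^sub>R x - u" and "d = x' - y"
  have x': "x' = y - (1 / L) *\<^sub>R gradient S h y"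
    by (simp add: x'_def s'_def y_def accel_step_def Let_def)
  have \<theta>: "1 \<le> \<theta>" "\<theta>'\<^sup>2 - \<theta>' = \<theta>\<^sup>2" "1 \<le> \<theta>'"
    using theta_accel_step[of s] assms by (auto simp: \<theta>_def \<theta>'_def s'_def)
  have "extrapolated s' = x' + ((\<theta> - 1) / \<theta>') *\<^sub>R (x' - x)"
    by (simp add: x'_def \<theta>'_def s'_def x_def \<theta>_def accel_step_def Let_def)
  then have "\<theta>' *\<^sub>R extrapolated s' = \<theta>' *\<^sub>R x' + (\<theta> - 1) *\<^sub>R (x' - x)"
    using \<theta>(3) by (simp add: scaleR_add_right)
  \<comment> \<open>The momentum coefficient is what makes the auxiliary point move by exactly
    \<open>\<theta>\<close> times \<open>d\<close>.\<close>
  then have w': "\<theta>' *\<^sub>R extrapolated s' - (\<theta>' - 1) *\<^sub>R x' - u = w + \<theta> *\<^sub>R d"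
    by (simp add: w_def d_def algebra_simps)
  \<comment> \<open>\<open>gradient_step\<close> towards \<open>x\<close> and towards
    \<open>u\<close>, with weights chosen so that the coefficients of \<open>h x'\<close> add up to
    the square of \<open>\<theta>\<close>.\<close>
  have "(\<theta>\<^sup>2 - \<theta>) * (h x' + L / 2 * (norm d)\<^sup>2 + L * inner (y - x) d) \<le> (\<theta>\<^sup>2 - \<theta>) * h x"
    using gradient_step[of y x] assms \<theta>(1)
    by (intro mult_left_mono) (auto simp: x' d_def x_def y_def power2_eq_square)
  moreover have "\<theta> * (h x' + L / 2 * (norm d)\<^sup>2 + L * inner (y - u) d) \<le> \<theta> * h u"
    using gradient_step[of y u] assms \<theta>(1)
    by (intro mult_left_mono) (auto simp: x' d_def y_def)
  moreover have "L / 2 * (norm (w + \<theta> *\<^sub>R d))\<^sup>2 = L / 2 * (norm w)\<^sup>2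
      + (\<theta>\<^sup>2 - \<theta>) * (L * inner (y - x) d) + \<theta> * (L * inner (y - u) d) + \<theta>\<^sup>2 * (L / 2 * (norm d)\<^sup>2)"
  proof -
    have "inner w d = (\<theta> - 1) * inner (y - x) d + inner (y - u) d"
      by (simp add: w_def algebra_simps)
    moreover have "(norm (w + \<theta> *\<^sub>R d))\<^sup>2 = (norm w)\<^sup>2 + 2 * \<theta> * inner w d + \<theta>\<^sup>2 * (norm d)\<^sup>2"
      by (simp only: power2_norm_eq_inner)
        (simp add: inner_add_left inner_add_right inner_commute power2_eq_square)
    ultimately show ?thesis
      by (simp only:) (simp add: field_simps power2_eq_square)
  qed
  ultimately have "\<theta>\<^sup>2 * (h x' - h u) + L / 2 * (norm (w + \<theta> *\<^sub>R d))\<^sup>2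
      \<le> (\<theta>\<^sup>2 - \<theta>) * (h x - h u) + L / 2 * (norm w)\<^sup>2"
    by (simp add: algebra_simps diff_divide_distrib add_divide_distrib)
  then show ?thesis
    unfolding energy_def s'_def[symmetric] x'_def[symmetric] \<theta>'_def[symmetric] w' \<theta>(2)
    by (simp add: x_def y_def \<theta>_def w_def)
qed

lemma accel_iterates:
  assumes "x0 \<in> S" "u \<in> S"
  defines "s \<equiv> \<lambda>k. (accel_step S h L ^^ k) (accel_init x0)"
  shows "iterate (s k) \<in> S \<and> extrapolated (s k) \<in> S \<and> 1 + real k / 2 \<le> theta (s k) \<and>
    energy u (s k) \<le> L / 2 * (norm (x0 - u))\<^sup>2"
proof (induction k)
  case 0
  then show ?case using assms by (simp add: accel_init_def energy_def)
next
  case (Suc k)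
  have s: "s (Suc k) = accel_step S h L (s k)"
    by (simp add: s_def)
  have "1 \<le> theta (s k)"
    using Suc by (auto intro: order_trans[rotated])
  then show ?case
    using Suc accel_step_in[of "s k"] theta_accel_step(2)[of "s k"]
      energy_accel_step[of "s k" u] \<open>u \<in> S\<close>
    unfolding s by (auto simp: field_simps)
qed

text \<open>The energy never exceeds its initial value, and its gap weight is at least
  \<open>k^2 / 4\<close>. As \<open>u\<close> need not minimize \<open>h\<close>, the gap may be
  negative; that case is trivial.\<close>

lemma accel_rate:
  assumes "x0 \<in> S" "u \<in> S" "0 < k"
  defines "x \<equiv> iterate ((accel_step S h L ^^ k) (accel_init x0))"
  shows "h x - h u \<le> 2 * L * (norm (x0 - u))\<^sup>2 / (real k)\<^sup>2"
proof (cases "h x \<le> h u")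
  case True
  then show ?thesis
    using L_pos by (smt (verit) divide_nonneg_nonneg mult_nonneg_nonneg zero_le_power2)
next
  case False
  define s where "s = (accel_step S h L ^^ k) (accel_init x0)"
  have s: "1 + real k / 2 \<le> theta s" "energy u s \<le> L / 2 * (norm (x0 - u))\<^sup>2"
    using accel_iterates[OF assms(1,2), of k] by (auto simp: s_def)
  have "real k / 2 * (real k / 2) \<le> theta s * (theta s - 1)"
    using s(1) by (intro mult_mono) auto
  then have "(real k)\<^sup>2 / 4 * (h x - h u) \<le> ((theta s)\<^sup>2 - theta s) * (h x - h u)"
    using False by (intro mult_right_mono) (auto simp: power2_eq_square algebra_simps)
  also have "\<dots> \<le> energy u s"
    using L_pos by (simp add: energy_def x_def s_def)
  finally show ?thesis
    using s(2) \<open>0 < k\<close> by (simp add: field_simps)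
qed

end

section \<open>Restarts of parallel processes\<close>

text \<open>Separates the combinatorics of restarts from the method that the processes run.
  \<open>T k\<close> bounds the iterations needed by process \<open>k\<close>;
  \<open>accomplish\<close> covers every larger \<open>i\<close> as well, because a process may
  already be under way when rounds start to be counted.\<close>

locale restart_scheme =
  fixes S :: "'a set" and f :: "'a \<Rightarrow> real"
    and step :: "real \<Rightarrow> 'a accel_state \<Rightarrow> 'a accel_state"
    and e :: "nat \<Rightarrow> real" and x0 :: 'a and \<sigma> :: "nat \<Rightarrow> 'a scheme_state"
    and fmin :: real and T :: "nat \<Rightarrow> nat"
  assumes run: "scheme_run f step e 1 x0 \<sigma>"
    and e_pos: "0 < e k"
    and x0_in: "x0 \<in> S"
    and iterate_in: "r \<in> S \<Longrightarrow> iterate ((step (e k) ^^ i) (accel_init r)) \<in> S"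
    and fmin_le: "x \<in> S \<Longrightarrow> fmin \<le> f x"
    and accomplish: "r \<in> S \<Longrightarrow> f r \<le> f x0 \<Longrightarrow> 2 * e k \<le> f r - fmin \<Longrightarrow> 0 < i \<Longrightarrow> T k \<le> i \<Longrightarrow>
      f (iterate ((step (e k) ^^ i) (accel_init r))) \<le> f r - e k"
begin

abbreviation procs :: "nat \<Rightarrow> nat" where
  "procs t \<equiv> n_procs (\<sigma> t)"

abbreviation ref :: "nat \<Rightarrow> nat \<Rightarrow> 'a" where
  "ref t k \<equiv> reference (\<sigma> t) k"

abbreviation new_iterate :: "nat \<Rightarrow> nat \<Rightarrow> 'a" where
  "new_iterate t k \<equiv> iterate (step (e k) (memory (\<sigma> t) k))"

definition accomplished :: "nat \<Rightarrow> nat \<Rightarrow> bool" where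
  "accomplished t k \<longleftrightarrow> f (best (\<sigma> (Suc t))) \<le> f (ref t k) - e k"

section \<open>Effect of one round and invariants of the state\<close>

lemma round: "scheme_round f step e (\<sigma> t) (\<sigma> (Suc t))"
  using run by (simp add: scheme_run_def)

lemma best_arg_min:
  "is_arg_min f (\<lambda>y. y \<in> new_iterate t ` {..<procs t}) (best (\<sigma> (Suc t)))"
  using round[of t] by (simp add: scheme_round_def Let_def)

lemma best_le: "k < procs t \<Longrightarrow> f (best (\<sigma> (Suc t))) \<le> f (new_iterate t k)"
  using best_arg_min[of t] by (auto simp: is_arg_min_linorder)

lemma best_attained: "\<exists>k<procs t. best (\<sigma> (Suc t)) = new_iterate t k"
  using best_arg_min[of t] by (auto simp: is_arg_min_def)

lemma restarted:
  "k < procs t \<Longrightarrow> accomplished t k \<Longrightarrow>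
    memory (\<sigma> (Suc t)) k = accel_init (best (\<sigma> (Suc t))) \<and> ref (Suc t) k = best (\<sigma> (Suc t))"
  using round[of t] by (auto simp: scheme_round_def Let_def accomplished_def)

lemma continued:
  "k < procs t \<Longrightarrow> \<not> accomplished t k \<Longrightarrow>
    memory (\<sigma> (Suc t)) k = step (e k) (memory (\<sigma> t) k) \<and> ref (Suc t) k = ref t k"
  using round[of t] by (auto simp: scheme_round_def Let_def accomplished_def)

lemma procs_Suc:
  "procs (Suc t) = (if accomplished t (procs t - 1) then procs t + 1 else procs t)"
  using round[of t] by (auto simp: scheme_round_def Let_def accomplished_def split: if_splits)

lemma launched:
  "accomplished t (procs t - 1) \<Longrightarrow>
    memory (\<sigma> (Suc t)) (procs t) = accel_init (best (\<sigma> (Suc t))) \<and>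
    ref (Suc t) (procs t) = best (\<sigma> (Suc t))"
  using round[of t] by (auto simp: scheme_round_def Let_def accomplished_def)

lemma init: "best (\<sigma> 0) = x0" "procs 0 = 1" "memory (\<sigma> 0) 0 = accel_init x0" "ref 0 0 = x0"
  using run by (auto simp: scheme_run_def scheme_init_def)

lemma procs_pos: "0 < procs t"
  by (induction t) (auto simp: init procs_Suc)

lemma procs_mono: "t \<le> t' \<Longrightarrow> procs t \<le> procs t'"
  by (rule lift_Suc_mono_le[of procs]) (auto simp: procs_Suc)

text \<open>Process \<open>k\<close> is \<open>i\<close> iterations past its last start, and none of
  these iterates accomplishes its task. One that did would have caused a restart, since the best
  iterate of a round is at least as good.\<close>

definition running :: "nat \<Rightarrow> nat \<Rightarrow> nat \<Rightarrow> bool" where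
  "running t k i \<longleftrightarrow> memory (\<sigma> t) k = (step (e k) ^^ i) (accel_init (ref t k)) \<and>
     (\<forall>j. 0 < j \<and> j \<le> i \<longrightarrow>
       f (ref t k) - e k < f (iterate ((step (e k) ^^ j) (accel_init (ref t k)))))"

lemma running_0: "memory (\<sigma> t) k = accel_init (ref t k) \<Longrightarrow> running t k 0"
  by (simp add: running_def)

lemma running_Suc:
  assumes "k < procs t" "\<not> accomplished t k" "running t k i"
  shows "running (Suc t) k (Suc i)"
  using assms continued[of k t] best_le[of k t]
  by (auto simp: running_def accomplished_def le_Suc_eq)

text \<open>\<open>best\<close> may be worse than \<open>x0\<close>, but it becomes a reference
  point only when some process accomplishes its task, which forces a decrease. The clause with
  \<open>best\<close> later turns a small reference gap into an \<epsilon>-optimal round.\<close>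

lemma state_invariant:
  "k < procs t \<Longrightarrow> ref t k \<in> S \<and> f (ref t k) \<le> f x0 \<and> (\<exists>s\<le>t. ref t k = best (\<sigma> s)) \<and>
    (\<exists>i. running t k i)"
proof (induction t arbitrary: k)
  case 0
  then show ?case using init x0_in running_0[of 0 0] by auto
next
  case (Suc t)
  let ?z = "best (\<sigma> (Suc t))"
  have z: "?z \<in> S"
  proof -
    obtain j where j: "j < procs t" "?z = new_iterate t j"
      using best_attained by blast
    obtain i where "running t j i" "ref t j \<in> S"
      using Suc.IH[OF j(1)] by auto
    then show ?thesis
      using iterate_in[of "ref t j" "Suc i" j] j(2) by (simp add: running_def)
  qed
  have acc: "f ?z \<le> f x0" if "j < procs t" "accomplished t j" for j
    using that Suc.IH[OF that(1)] e_pos[of j] by (auto simp: accomplished_def)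
  show ?case
  proof (cases "k < procs t")
    case True
    show ?thesis
    proof (cases "accomplished t k")
      case True
      then show ?thesis
        using restarted[OF \<open>k < procs t\<close> True] z acc[OF \<open>k < procs t\<close> True] running_0[of "Suc t" k] by auto
    next
      case False
      obtain i where "running t k i"
        using Suc.IH[OF \<open>k < procs t\<close>] by auto
      then have "running (Suc t) k (Suc i)"
        using running_Suc \<open>k < procs t\<close> False by blast
      then show ?thesis
        using continued[OF \<open>k < procs t\<close> False] Suc.IH[OF \<open>k < procs t\<close>] by (auto intro: le_SucI)
    qed
  next
    case False
    then have "accomplished t (procs t - 1)" "k = procs t"
      using Suc.prems by (auto simp: procs_Suc split: if_splits)
    then show ?thesis
      using launched[of t] z acc[of "procs t - 1"] procs_pos[of t] running_0[of "Suc t" k] by auto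
  qed
qed

lemma best_in: "best (\<sigma> t) \<in> S"
proof (cases t)
  case 0
  then show ?thesis by (simp add: init x0_in)
next
  case (Suc s)
  obtain j where j: "j < procs s" "best (\<sigma> t) = new_iterate s j"
    using best_attained Suc by blast
  obtain i where "running s j i" "ref s j \<in> S"
    using state_invariant[OF j(1)] by auto
  then show ?thesis
    using iterate_in[of "ref s j" "Suc i" j] j(2) by (simp add: running_def)
qed

lemma ref_Suc_le: "k < procs t \<Longrightarrow> f (ref (Suc t) k) \<le> f (ref t k)"
  using restarted[of k t] continued[of k t] e_pos[of k]
  by (cases "accomplished t k") (auto simp: accomplished_def)

text \<open>When a process moves its reference point, every process of smaller index either restarts at
  the same point or is already within its target of it.\<close>

lemma ref_close: "j < i \<Longrightarrow> i < procs t \<Longrightarrow> f (ref t j) < f (ref t i) + e j"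
proof (induction t arbitrary: i j)
  case 0
  then show ?case by (simp add: init)
next
  case (Suc t)
  have j: "j < procs t"
    using Suc.prems by (auto simp: procs_Suc split: if_splits)
  show ?case
  proof (cases "i < procs t \<and> \<not> accomplished t i")
    case True
    then show ?thesis
      using continued[of i t] ref_Suc_le[OF j] Suc.IH[OF Suc.prems(1)] by auto
  next
    case False
    have "ref (Suc t) i = best (\<sigma> (Suc t))"
    proof (cases "i < procs t")
      case True
      with False restarted show ?thesis by blast
    next
      case False
      then have "accomplished t (procs t - 1)" "i = procs t"
        using Suc.prems by (auto simp: procs_Suc split: if_splits)
      then show ?thesis using launched[of t] by simp
    qed
    moreover have "f (ref (Suc t) j) < f (best (\<sigma> (Suc t))) + e j"
      using restarted[OF j] continued[OF j] e_pos[of j]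
      by (cases "accomplished t j") (auto simp: accomplished_def)
    ultimately show ?thesis by simp
  qed
qed

text \<open>The count \<open>i\<close> is only bounded below by \<open>d\<close>, because at round
  \<open>t\<close> the process may already be some iterations into its run.\<close>

lemma restart_or_run:
  assumes "k < procs t"
  shows "(\<exists>t'. t \<le> t' \<and> t' < t + d \<and> accomplished t' k \<and> ref t' k = ref t k) \<or>
    (ref (t + d) k = ref t k \<and> (\<exists>i\<ge>d. running (t + d) k i))"
proof (induction d)
  case 0
  then show ?case using state_invariant[OF assms] by auto
next
  case (Suc d)
  have k: "k < procs (t + d)"
    using assms procs_mono[of t "t + d"] by simp
  show ?case
  proof (cases "\<exists>t'. t \<le> t' \<and> t' < t + d \<and> accomplished t' k \<and> ref t' k = ref t k")
    case True
    then show ?thesis by fastforce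
  next
    case False
    then obtain i where i: "i \<ge> d" "running (t + d) k i" and r: "ref (t + d) k = ref t k"
      using Suc by blast
    show ?thesis
    proof (cases "accomplished (t + d) k")
      case True
      then have "t \<le> t + d \<and> t + d < t + Suc d \<and> accomplished (t + d) k \<and> ref (t + d) k = ref t k"
        using r by simp
      then show ?thesis by blast
    next
      case False
      have "running (t + Suc d) k (Suc i)" "ref (t + Suc d) k = ref t k"
        using running_Suc[OF k False i(2)] continued[OF k False] r by auto
      then show ?thesis using i(1) by blast
    qed
  qed
qed

text \<open>Otherwise process \<open>k\<close> would make at least \<open>T k\<close> iterations
  without accomplishing its task, against \<open>accomplish\<close>. The restart may be due to an
  iterate of another process. If \<open>k\<close> is the highest index, the restart launches its
  successor.\<close>

lemma restart_within:
  assumes k: "k < procs t" and gap: "2 * e k \<le> f (ref t k) - fmin" and T: "0 < T k"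
  obtains t' where "t < t'" "t' \<le> t + T k" "f (ref t' k) \<le> f (ref t k) - e k" "Suc k < procs t'"
proof -
  have inv: "ref t k \<in> S" "f (ref t k) \<le> f x0"
    using state_invariant[OF k] by auto
  have "\<exists>t'. t \<le> t' \<and> t' < t + T k \<and> accomplished t' k \<and> ref t' k = ref t k"
  proof (rule ccontr)
    assume "\<not> ?thesis"
    then obtain i where i: "ref (t + T k) k = ref t k" "T k \<le> i" "running (t + T k) k i"
      using restart_or_run[OF k, of "T k"] by blast
    then have "f (ref t k) - e k < f (iterate ((step (e k) ^^ i) (accel_init (ref t k))))"
      using T by (auto simp: running_def)
    then show False
      using accomplish[OF inv gap, of i] i T by simp
  qed
  then obtain t' where t': "t \<le> t'" "t' < t + T k" "accomplished t' k" "ref t' k = ref t k"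
    by blast
  have k': "k < procs t'"
    using k procs_mono[OF t'(1)] by simp
  show ?thesis
  proof (rule that[of "Suc t'"])
    show "f (ref (Suc t') k) \<le> f (ref t k) - e k"
      using restarted[OF k' t'(3)] t'(3,4) by (auto simp: accomplished_def)
    show "Suc k < procs (Suc t')"
    proof (cases "Suc k < procs t'")
      case True
      then show ?thesis using procs_mono[of t' "Suc t'"] by simp
    next
      case False
      then have "procs t' - 1 = k" using k' by simp
      then show ?thesis using t'(3) k' by (simp add: procs_Suc)
    qed
  qed (use t' in auto)
qed

text \<open>While the gap is at least \<open>2 * e k\<close>, every \<open>T k\<close> rounds
  contain a restart that lowers it by at least \<open>e k\<close>.\<close>

lemma descend:
  assumes "k < procs t" "f (ref t k) - fmin < 2 * e k + real n * e k" "0 < T k"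
  shows "\<exists>t'\<ge>t. t' \<le> t + n * T k \<and> f (ref t' k) - fmin < 2 * e k"
  using assms(1,2)
proof (induction n arbitrary: t)
  case 0
  then show ?case by auto
next
  case (Suc n)
  show ?case
  proof (cases "2 * e k \<le> f (ref t k) - fmin")
    case False
    then show ?thesis by (intro exI[of _ t]) auto
  next
    case True
    obtain s where s: "t < s" "s \<le> t + T k" "f (ref s k) \<le> f (ref t k) - e k"
      using restart_within[OF Suc.prems(1) True assms(3)] by blast
    have "f (ref s k) - fmin < 2 * e k + real n * e k"
      using s(3) Suc.prems(2) by (simp add: algebra_simps)
    moreover have "k < procs s"
      using Suc.prems(1) procs_mono[of t s] s(1) by simp
    ultimately obtain t' where "s \<le> t'" "t' \<le> s + n * T k" "f (ref t' k) - fmin < 2 * e k"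
      using Suc.IH[of s] by blast
    then show ?thesis using s(1,2) by (intro exI[of _ t']) auto
  qed
qed

text \<open>A process with a large gap restarts and so ensures that its successor exists. If some
  process already has a small gap, waiting for further launches is pointless: the way down can begin
  there.\<close>

lemma launch:
  assumes "\<And>k. 0 < T k"
  shows "\<exists>t\<le>\<Sum>j<n. T j. n < procs t \<or> (\<exists>k<n. k < procs t \<and> f (ref t k) - fmin < 2 * e k)"
proof (induction n)
  case 0
  then show ?case using procs_pos by auto
next
  case (Suc n)
  then obtain t where t: "t \<le> (\<Sum>j<n. T j)"
    "n < procs t \<or> (\<exists>k<n. k < procs t \<and> f (ref t k) - fmin < 2 * e k)"
    by blast
  show ?case
  proof (cases "\<exists>k<Suc n. k < procs t \<and> f (ref t k) - fmin < 2 * e k")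
    case True
    then show ?thesis using t(1) by (intro exI[of _ t]) auto
  next
    case False
    then have "n < procs t" "2 * e n \<le> f (ref t n) - fmin"
      using t(2) by force+
    then obtain s where "s \<le> t + T n" "Suc n < procs s"
      using restart_within assms by metis
    then show ?thesis using t(1) by (intro exI[of _ s]) auto
  qed
qed

text \<open>Two phases: launch processes until one has gap below twice its target, then go down
  index by index to process 0. Stage \<open>j\<close> costs \<open>T j\<close> rounds on the way up
  and \<open>n j * T j\<close> on the way down.\<close>

lemma reach:
  assumes T: "\<And>k. 0 < T k" and mono: "\<And>k. e k \<le> e (Suc k)"
    and m: "f x0 - fmin < 2 * e m"
  shows "\<exists>t. f (best (\<sigma> t)) - fmin < 2 * e 0 \<and>
    real t \<le> (\<Sum>j<m. 4 * (e (Suc j) / e j) * real (T j))"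
proof -
  \<comment> \<open>Enough restarts to get from \<open>2 * e (Suc j) + e j\<close>, the bound
    supplied by \<open>ref_close\<close>, to below \<open>2 * e j\<close>. Rounding up costs at most
    one more ratio, as ratios are at least 1.\<close>
  define n where "n j = nat \<lceil>2 * e (Suc j) / e j\<rceil>" for j
  have n: "2 * e (Suc j) \<le> real (n j) * e j" "real (n j) \<le> 3 * (e (Suc j) / e j)" for j
  proof -
    have "2 * e (Suc j) / e j \<le> real (n j)"
      unfolding n_def by linarith
    then show "2 * e (Suc j) \<le> real (n j) * e j"
      using e_pos[of j] by (simp add: field_simps)
    have "1 \<le> e (Suc j) / e j"
      using e_pos[of j] mono[of j] by simp
    then show "real (n j) \<le> 3 * (e (Suc j) / e j)"
      unfolding n_def by linarith
  qed
  have down: "\<exists>t'\<le>t + (\<Sum>j<k. n j * T j). 0 < procs t' \<and> f (ref t' 0) - fmin < 2 * e 0"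
    if "k < procs t" "f (ref t k) - fmin < 2 * e k" for k t
    using that
  proof (induction k arbitrary: t)
    case (Suc k)
    have k: "k < procs t" using Suc.prems by simp
    have "f (ref t k) - fmin < 2 * e k + real (n k) * e k"
      using ref_close[of k "Suc k" t] Suc.prems n(1)[of k] e_pos[of k] by linarith
    then obtain s where s: "t \<le> s" "s \<le> t + n k * T k" "f (ref s k) - fmin < 2 * e k"
      using descend[OF k _ T] by blast
    have "k < procs s" using k procs_mono[OF s(1)] by simp
    then obtain t' where "t' \<le> s + (\<Sum>j<k. n j * T j)" "0 < procs t'" "f (ref t' 0) - fmin < 2 * e 0"
      using Suc.IH s(3) by blast
    then show ?case using s(2) by (intro exI[of _ t']) auto
  qed auto
  obtain t k where t: "t \<le> (\<Sum>j<m. T j)" "k \<le> m" "k < procs t" "f (ref t k) - fmin < 2 * e k"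
  proof -
    obtain t where t: "t \<le> (\<Sum>j<m. T j)"
      "m < procs t \<or> (\<exists>k<m. k < procs t \<and> f (ref t k) - fmin < 2 * e k)"
      using launch[OF T] by blast
    \<comment> \<open>Once process \<open>m\<close> exists its gap is small enough automatically,
      since no reference point is worse than \<open>x0\<close>.\<close>
    have "f (ref t m) - fmin < 2 * e m" if "m < procs t"
      using state_invariant[OF that] m by linarith
    then show ?thesis using t that by (meson less_imp_le order_refl)
  qed
  then obtain t' where t': "t' \<le> t + (\<Sum>j<k. n j * T j)" "0 < procs t'" "f (ref t' 0) - fmin < 2 * e 0"
    using down by blast
  have "(\<Sum>j<k. n j * T j) \<le> (\<Sum>j<m. n j * T j)"
    using t(2) by (intro sum_mono2) auto
  then have "t' \<le> (\<Sum>j<m. T j + n j * T j)"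
    using t(1) t'(1) by (simp add: sum.distrib)
  then have "real t' \<le> (\<Sum>j<m. real (T j) + real (n j) * real (T j))"
    by (metis (mono_tags, lifting) of_nat_add of_nat_le_iff of_nat_mult of_nat_sum sum.cong)
  also have "\<dots> \<le> (\<Sum>j<m. 4 * (e (Suc j) / e j) * real (T j))"
  proof (rule sum_mono)
    fix j
    have "1 \<le> e (Suc j) / e j"
      using e_pos[of j] mono[of j] by simp
    then have "1 + real (n j) \<le> 4 * (e (Suc j) / e j)"
      using n(2)[of j] by linarith
    then have "(1 + real (n j)) * real (T j) \<le> 4 * (e (Suc j) / e j) * real (T j)"
      by (rule mult_right_mono) simp
    then show "real (T j) + real (n j) * real (T j) \<le> 4 * (e (Suc j) / e j) * real (T j)"
      by (simp only: distrib_right mult_1)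
  qed
  finally have "real t' \<le> (\<Sum>j<m. 4 * (e (Suc j) / e j) * real (T j))" .
  moreover obtain s where "s \<le> t'" "ref t' 0 = best (\<sigma> s)"
    using state_invariant[OF t'(2)] by blast
  ultimately show ?thesis
    using t'(3) by (intro exI[of _ s]) auto
qed

text \<open>Accomplishing the task of process \<open>m\<close> would push \<open>f\<close> below
  \<open>fmin\<close>, so this process never launches a successor.\<close>

lemma procs_le:
  assumes "f x0 - fmin < e m"
  shows "procs t \<le> m + 1"
proof (induction t)
  case (Suc t)
  have "\<not> accomplished t m" if "m < procs t"
    using state_invariant[OF that] fmin_le[OF best_in[of "Suc t"]] assms
    by (auto simp: accomplished_def)
  then show ?case
    using Suc by (cases "procs t = m + 1") (auto simp: procs_Suc)
qed (simp add: init)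

end

section \<open>Complexity of the scheme with the smoothing method\<close>

lemma min_value_eq:
  assumes "u \<in> minimizers S f"
  shows "min_value S f = f u"
  unfolding min_value_def using assms
  by (intro cInf_eq_minimum) (auto simp: minimizers_def is_arg_min_linorder)

lemma min_value_le:
  assumes "minimizers S f \<noteq> {}" "x \<in> S"
  shows "min_value S f \<le> f x"
proof -
  obtain u where u: "u \<in> minimizers S f" using assms(1) by blast
  then have "f u \<le> f x"
    using assms(2) by (auto simp: minimizers_def is_arg_min_linorder)
  then show ?thesis by (simp add: min_value_eq[OF u])
qed

lemma smooth_convex_smoothing:
  assumes "subspace S" "smoothing_family S f \<alpha> \<beta> F" "0 < \<alpha>" "0 < \<eta>"
  shows "smooth_convex S (F \<eta>) (\<alpha> / \<eta>)"
  using assms by unfold_locales (auto simp: smoothing_family_def)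

lemma smoothing_step_in:
  assumes "subspace S" "smoothing_family S f \<alpha> \<beta> F" "0 < \<alpha>" "0 < \<beta>" "0 < \<epsilon>" "r \<in> S"
  shows "iterate ((smoothing_step S \<alpha> \<beta> F \<epsilon> ^^ k) (accel_init r)) \<in> S"
proof -
  interpret smooth_convex S "F (\<epsilon> / (4 * \<beta>))" "\<alpha> / (\<epsilon> / (4 * \<beta>))"
    using assms by (intro smooth_convex_smoothing) auto
  have "smoothing_step S \<alpha> \<beta> F \<epsilon> = accel_step S (F (\<epsilon> / (4 * \<beta>))) (\<alpha> / (\<epsilon> / (4 * \<beta>)))"
    by (simp add: smoothing_step_def Let_def)
  then show ?thesis using accel_iterates[OF assms(6,6)] by metis
qed

text \<open>The choice of \<open>\<eta>\<close> gives smoothing error \<open>\<epsilon> / 4\<close>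
  and \<open>2 * L = 8 * \<alpha> * \<beta> / \<epsilon>\<close>. The error enters only once, at
  \<open>u\<close>, because the smoothing lies above \<open>f\<close>.\<close>

lemma smoothing_rate:
  assumes "subspace S" "smoothing_family S f \<alpha> \<beta> F" "0 < \<alpha>" "0 < \<beta>" "0 < \<epsilon>"
    and "r \<in> S" "u \<in> S" "0 < k"
  shows "f (iterate ((smoothing_step S \<alpha> \<beta> F \<epsilon> ^^ k) (accel_init r)))
    \<le> f u + 8 * \<alpha> * \<beta> * (norm (r - u))\<^sup>2 / (\<epsilon> * (real k)\<^sup>2) + \<epsilon> / 4"
proof -
  define \<eta> where "\<eta> = \<epsilon> / (4 * \<beta>)"
  have \<eta>: "0 < \<eta>" using assms by (simp add: \<eta>_def)
  interpret smooth_convex S "F \<eta>" "\<alpha> / \<eta>"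
    using assms \<eta> by (intro smooth_convex_smoothing) auto
  have step: "smoothing_step S \<alpha> \<beta> F \<epsilon> = accel_step S (F \<eta>) (\<alpha> / \<eta>)"
    by (simp add: smoothing_step_def Let_def \<eta>_def)
  define x where "x = iterate ((accel_step S (F \<eta>) (\<alpha> / \<eta>) ^^ k) (accel_init r))"
  have approx: "f y \<le> F \<eta> y" "F \<eta> y \<le> f y + \<beta> * \<eta>" if "y \<in> S" for y
    using assms(2) \<eta> that by (auto simp: smoothing_family_def)
  have "x \<in> S"
    using accel_iterates[OF assms(6,6)] by (simp add: x_def)
  then have "f x \<le> F \<eta> u + 2 * (\<alpha> / \<eta>) * (norm (r - u))\<^sup>2 / (real k)\<^sup>2"
    using accel_rate[OF assms(6-8)] approx(1)[of x] by (simp add: x_def)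
  also have "\<dots> \<le> f u + 8 * \<alpha> * \<beta> * (norm (r - u))\<^sup>2 / (\<epsilon> * (real k)\<^sup>2) + \<epsilon> / 4"
    using approx(2)[OF assms(7)] assms(4,5) by (simp add: \<eta>_def mult_ac)
  finally show ?thesis by (simp add: step x_def)
qed

lemma iteration_rate_pos:
  "0 < \<alpha> \<Longrightarrow> 0 < \<beta> \<Longrightarrow> 0 < \<mu> \<Longrightarrow> 0 < \<epsilon> \<Longrightarrow> 0 < iteration_rate p \<alpha> \<beta> \<mu> \<epsilon>"
  by (simp add: iteration_rate_def)

lemma iteration_rate_powr:
  "iteration_rate p \<alpha> \<beta> \<mu> \<epsilon> = sqrt (\<alpha> * \<beta>) / \<mu> powr (1 / p) * \<epsilon> powr - (1 - 1 / p)"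
  unfolding iteration_rate_def powr_minus by (simp add: divide_inverse)

lemma smoothing_accomplishes:
  assumes S: "subspace S" "smoothing_family S f \<alpha> \<beta> F"
    and pos: "0 < \<alpha>" "0 < \<beta>" "0 < \<mu>" "0 < \<epsilon>" and p: "2 \<le> p"
    and X: "minimizers S f \<noteq> {}" and r: "r \<in> S"
    and growth: "\<mu> * infdist r (minimizers S f) powr p \<le> f r - min_value S f"
    and gap: "2 * \<epsilon> \<le> f r - min_value S f"
    and k: "0 < k" "10 * iteration_rate p \<alpha> \<beta> \<mu> \<epsilon> \<le> real k"
  shows "f (iterate ((smoothing_step S \<alpha> \<beta> F \<epsilon> ^^ k) (accel_init r))) \<le> f r - \<epsilon>"
proof -
  define X where "X = minimizers S f"
  define \<delta> where "\<delta> = f r - min_value S f"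
  define D where "D = (\<delta> / \<mu>) powr (1 / p)"
  have \<delta>: "2 * \<epsilon> \<le> \<delta>" "0 < \<delta>" using gap pos by (auto simp: \<delta>_def)
  have "infdist r X = (infdist r X powr p) powr (1 / p)"
    using p by (simp add: powr_powr infdist_nonneg)
  also have "\<dots> \<le> D"
    unfolding D_def using growth pos p by (intro powr_mono2) (auto simp: X_def \<delta>_def field_simps)
  \<comment> \<open>The factor 2 gives a strict inequality, so an actual minimizer can be picked
    from the infimum without knowing that it is attained.\<close>
  also have "D < 2 * D" using \<delta> pos by (simp add: D_def)
  finally have "(INF u\<in>X. dist r u) < 2 * D"
    using X by (simp add: X_def infdist_notempty)
  then obtain u where u: "u \<in> X" "dist r u < 2 * D"
    using X by (subst (asm) cINF_less_iff) (auto simp: X_def intro: bdd_belowI2[of _ 0])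
  have uS: "u \<in> S" using u(1) by (simp add: X_def minimizers_def is_arg_min_linorder)
  have fu: "f u = min_value S f" using min_value_eq u(1) by (metis X_def)
  have "(norm (r - u))\<^sup>2 \<le> (2 * D)\<^sup>2"
    using u(2) by (intro power_mono) (auto simp: dist_norm)
  then have nu: "(norm (r - u))\<^sup>2 \<le> 4 * D\<^sup>2" by (simp add: power_mult_distrib)
  \<comment> \<open>\<open>C\<close> is \<epsilon> times the square of the iteration rate.\<close>
  define C where "C = \<alpha> * \<beta> / \<mu> powr (2 / p) * \<epsilon> powr (2 / p - 1)"
  have sq: "(y powr z)\<^sup>2 = y powr (2 * z)" for y z :: real
    by (simp add: power2_eq_square flip: powr_add)
  have "D\<^sup>2 = \<delta> * \<delta> powr (2 / p - 1) / \<mu> powr (2 / p)"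
    using \<delta>(2) pos by (simp add: D_def sq powr_divide power_divide powr_mult_base)
  also have "\<dots> \<le> \<delta> * \<epsilon> powr (2 / p - 1) / \<mu> powr (2 / p)"
    using \<delta> pos p by (intro divide_right_mono mult_left_mono powr_mono2') auto
  finally have "\<alpha> * \<beta> * D\<^sup>2 \<le> \<alpha> * \<beta> * (\<delta> * \<epsilon> powr (2 / p - 1) / \<mu> powr (2 / p))"
    using pos by (intro mult_left_mono) auto
  then have D: "\<alpha> * \<beta> * D\<^sup>2 \<le> C * \<delta>" by (simp add: C_def mult_ac)
  have "(10 * iteration_rate p \<alpha> \<beta> \<mu> \<epsilon>)\<^sup>2 \<le> (real k)\<^sup>2"
    using k(2) iteration_rate_pos[of \<alpha> \<beta> \<mu> \<epsilon> p] pos by (intro power_mono) auto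
  moreover have "\<epsilon> * (10 * iteration_rate p \<alpha> \<beta> \<mu> \<epsilon>)\<^sup>2 = 100 * C"
  proof -
    have "\<epsilon> * (\<epsilon> powr - (1 - 1 / p))\<^sup>2 = \<epsilon> powr (2 / p - 1)"
      using pos by (simp add: sq powr_mult_base)
    moreover have "(sqrt (\<alpha> * \<beta>))\<^sup>2 = \<alpha> * \<beta>" using pos by simp
    ultimately show ?thesis
      unfolding C_def iteration_rate_powr by (simp add: power_mult_distrib power_divide sq mult_ac)
  qed
  ultimately have "100 * C \<le> \<epsilon> * (real k)\<^sup>2"
    using mult_left_mono[of _ _ \<epsilon>] pos by fastforce
  then have "100 * C * \<delta> \<le> \<epsilon> * (real k)\<^sup>2 * \<delta>"
    using \<delta> by (intro mult_right_mono) auto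
  moreover have "8 * \<alpha> * \<beta> * (norm (r - u))\<^sup>2 \<le> 8 * \<alpha> * \<beta> * (4 * D\<^sup>2)"
    using nu pos by (intro mult_left_mono) auto
  moreover have "0 \<le> \<epsilon> * (real k)\<^sup>2 * \<delta>"
    using pos \<delta> by simp
  \<comment> \<open>The constant 10 in the iteration count suffices here: \<open>8 * 4 = 32\<close>
    is at most \<open>3 / 8 * 10^2\<close>.\<close>
  ultimately have "8 * \<alpha> * \<beta> * (norm (r - u))\<^sup>2 \<le> 3 / 8 * (\<epsilon> * (real k)\<^sup>2 * \<delta>)"
    using D by simp
  then have "8 * \<alpha> * \<beta> * (norm (r - u))\<^sup>2 \<le> 3 / 8 * \<delta> * (\<epsilon> * (real k)\<^sup>2)"
    by (simp add: mult_ac)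
  then have "8 * \<alpha> * \<beta> * (norm (r - u))\<^sup>2 / (\<epsilon> * (real k)\<^sup>2) \<le> 3 / 8 * \<delta>"
    using pos k(1) by (simp add: pos_divide_le_eq)
  then have "f (iterate ((smoothing_step S \<alpha> \<beta> F \<epsilon> ^^ k) (accel_init r))) \<le> f u + 3 / 8 * \<delta> + \<epsilon> / 4"
    by (intro order_trans[OF smoothing_rate[OF S pos(1,2,4) r uS k(1)]]) simp
  also have "\<dots> = f r - \<delta> + 3 / 8 * \<delta> + \<epsilon> / 4"
    by (simp add: fu \<delta>_def)
  \<comment> \<open>The remaining \<open>5 / 8 * \<delta>\<close> is at least
    \<open>5 / 4 * \<epsilon>\<close>, exactly by the assumed gap
    \<open>2 * \<epsilon>\<close>.\<close>
  also have "\<dots> \<le> f r - \<epsilon>"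
    using \<delta>(1) by simp
  finally show ?thesis .
qed

section \<open>Total cost of the stages\<close>

lemma summable_exp_power:
  fixes b c :: real
  assumes "0 < b" "1 < c"
  shows "summable (\<lambda>k. exp (- (b * c ^ k)))"
proof (rule summable_comparison_test')
  show "summable (\<lambda>k. exp (- (b * (c - 1))) ^ k)"
    using assms by (intro summable_geometric) simp
  fix k :: nat
  \<comment> \<open>Bernoulli's inequality provides the geometric majorant.\<close>
  have "real k * (c - 1) \<le> c ^ k"
    using Bernoulli_inequality[of "c - 1" k] assms by simp
  then have "b * (real k * (c - 1)) \<le> b * c ^ k"
    using assms by simp
  then show "norm (exp (- (b * c ^ k))) \<le> exp (- (b * (c - 1))) ^ k"
    by (simp add: mult_ac flip: exp_of_nat_mult)
qed

definition exp_power_sum :: "real \<Rightarrow> real \<Rightarrow> real" where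
  "exp_power_sum b c = (\<Sum>k. exp (- (b * c ^ k)))"

lemma exp_power_sum_ge:
  "0 < b \<Longrightarrow> 1 < c \<Longrightarrow> (\<Sum>k<m. exp (- (b * c ^ k))) \<le> exp_power_sum b c"
  unfolding exp_power_sum_def by (intro sum_le_suminf summable_exp_power) auto

lemma exp_power_sum_nonneg: "0 < b \<Longrightarrow> 1 < c \<Longrightarrow> 0 \<le> exp_power_sum b c"
  using exp_power_sum_ge[of b c 0] by simp

text \<open>The exponent \<open>r\<close> lies strictly between \<open>c - 1\<close> and \<open>1 - 1 / p\<close>; the term with \<open>r\<close> accounts
  for the rounding of the iteration counts to integers and is of lower order in \<open>\<epsilon>\<close>.\<close>

lemma stage_sum_bound:
  fixes c q r A a :: real and T :: "nat \<Rightarrow> nat"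
  defines "e \<equiv> \<lambda>k. a * exp (c ^ k)"
  assumes c: "1 < c" "c < 1 + q" "c < 1 + r" "0 < r" and a: "0 < a" and A: "0 \<le> A"
    and m: "\<And>k. k < m \<Longrightarrow> exp (c ^ k) \<le> Y"
    and T: "\<And>k. real (T k) \<le> A * e k powr - q + 1"
  shows "(\<Sum>k<m. 4 * (e (Suc k) / e k) * real (T k))
    \<le> 4 * A * a powr - q * exp_power_sum (1 + q - c) c + 4 * Y powr r * exp_power_sum (1 + r - c) c"
proof -
  \<comment> \<open>Multiplied by \<open>e k powr - q\<close>, this ratio is a constant times
    \<open>exp (- ((1 + q - c) * c ^ k))\<close>, which decays because
    \<open>c < 1 + q\<close>.\<close>
  have ratio: "e (Suc k) / e k = exp ((c - 1) * c ^ k)" for k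
    using a by (simp add: e_def algebra_simps exp_diff)
  have "4 * (e (Suc k) / e k) * real (T k) \<le>
      4 * A * a powr - q * exp (- ((1 + q - c) * c ^ k)) + 4 * Y powr r * exp (- ((1 + r - c) * c ^ k))"
    if "k < m" for k
  proof -
    have "exp (c ^ k) powr r \<le> Y powr r"
      using m[OF that] c(4) by (intro powr_mono2) auto
    then have "exp (c ^ k) powr r * exp (- ((1 + r - c) * c ^ k)) \<le> Y powr r * exp (- ((1 + r - c) * c ^ k))"
      by (intro mult_right_mono) auto
    moreover have "exp (c ^ k) powr r * exp (- ((1 + r - c) * c ^ k)) = exp ((c - 1) * c ^ k)"
      by (simp add: powr_def algebra_simps flip: exp_add)
    moreover have "exp ((c - 1) * c ^ k) * e k powr - q = a powr - q * exp (- ((1 + q - c) * c ^ k))"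
      using a by (simp add: e_def powr_def ln_mult algebra_simps flip: exp_add)
    moreover have "exp ((c - 1) * c ^ k) * real (T k) \<le> exp ((c - 1) * c ^ k) * (A * e k powr - q + 1)"
      using T by (intro mult_left_mono) auto
    then have "exp ((c - 1) * c ^ k) * real (T k)
        \<le> A * (exp ((c - 1) * c ^ k) * e k powr - q) + exp ((c - 1) * c ^ k)"
      by (simp add: algebra_simps)
    ultimately show ?thesis
      unfolding ratio by simp
  qed
  then have "(\<Sum>k<m. 4 * (e (Suc k) / e k) * real (T k)) \<le>
      (\<Sum>k<m. 4 * A * a powr - q * exp (- ((1 + q - c) * c ^ k)) + 4 * Y powr r * exp (- ((1 + r - c) * c ^ k)))"
    by (intro sum_mono) auto
  also have "\<dots> = 4 * A * a powr - q * (\<Sum>k<m. exp (- ((1 + q - c) * c ^ k)))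
      + 4 * Y powr r * (\<Sum>k<m. exp (- ((1 + r - c) * c ^ k)))"
    by (simp add: sum.distrib sum_distrib_left)
  also have "\<dots> \<le> 4 * A * a powr - q * exp_power_sum (1 + q - c) c
      + 4 * Y powr r * exp_power_sum (1 + r - c) c"
    using c A by (intro add_mono mult_left_mono exp_power_sum_ge) auto
  finally show ?thesis .
qed

text \<open>Valid without any smallness of \<epsilon>: the lower-order term with exponent
  \<open>r\<close> stays explicit and is absorbed only in the asymptotic statement.\<close>

lemma scheme_complexity:
  fixes S :: "'a::real_inner set" and f F x0 \<sigma> and \<alpha> \<beta> \<mu> p c r \<epsilon> \<Delta> :: real
  assumes S: "subspace S" "smoothing_family S f \<alpha> \<beta> F" "minimizers S f \<noteq> {}" "x0 \<in> S"
    and growth: "\<And>x. x \<in> S \<Longrightarrow> f x \<le> f x0 \<Longrightarrow>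
      \<mu> * infdist x (minimizers S f) powr p \<le> f x - min_value S f"
    and pos: "0 < \<alpha>" "0 < \<beta>" "0 < \<mu>" "0 < \<epsilon>" and p: "2 \<le> p"
    and c: "1 < c" "c < 2 - 1 / p" "c - 1 < r"
    and \<Delta>: "\<Delta> = f x0 - min_value S f" "\<epsilon> < \<Delta>"
    and run: "scheme_run f (smoothing_step S \<alpha> \<beta> F) (\<lambda>k. \<epsilon> / (2 * exp 1) * exp (c ^ k)) 1 x0 \<sigma>"
  shows "\<exists>t. eps_optimal S f \<epsilon> (best (\<sigma> t)) \<and>
      real t \<le> 240 * exp_power_sum (2 - 1 / p - c) c * iteration_rate p \<alpha> \<beta> \<mu> \<epsilon>
        + 4 * (exp 1 * \<Delta> / \<epsilon>) powr r * exp_power_sum (1 + r - c) c" (is "\<exists>t. _ \<and> _ \<le> ?b")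
    and "real (n_procs (\<sigma> s)) \<le> ln (ln (2 * exp 1 * \<Delta> / \<epsilon>)) / ln c + 3"
proof -
  define a where "a = \<epsilon> / (2 * exp 1)"
  define e where "e k = a * exp (c ^ k)" for k :: nat
  define T where "T k = nat \<lceil>10 * iteration_rate p \<alpha> \<beta> \<mu> (e k)\<rceil>" for k
  have a: "0 < a" using pos by (simp add: a_def)
  have e_pos: "0 < e k" for k using a by (simp add: e_def)
  have T_pos: "0 < T k" for k
    using iteration_rate_pos[of \<alpha> \<beta> \<mu> "e k" p] pos e_pos[of k] by (simp add: T_def)
  interpret restart_scheme S f "smoothing_step S \<alpha> \<beta> F" e x0 \<sigma> "min_value S f" T
  proof
    show "scheme_run f (smoothing_step S \<alpha> \<beta> F) e 1 x0 \<sigma>"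
      using run by (simp add: e_def[abs_def] a_def)
    show "min_value S f \<le> f x" if "x \<in> S" for x
      using S(3) that by (rule min_value_le)
    show "iterate ((smoothing_step S \<alpha> \<beta> F (e k) ^^ i) (accel_init r)) \<in> S" if "r \<in> S" for r i k
      using S(1,2) pos(1,2) e_pos that by (rule smoothing_step_in)
    fix r k i
    assume *: "r \<in> S" "f r \<le> f x0" "2 * e k \<le> f r - min_value S f" "0 < i" "T k \<le> i"
    then have "10 * iteration_rate p \<alpha> \<beta> \<mu> (e k) \<le> real i"
      unfolding T_def by linarith
    then show "f (iterate ((smoothing_step S \<alpha> \<beta> F (e k) ^^ i) (accel_init r))) \<le> f r - e k"
      using * growth by (intro smoothing_accomplishes[OF S(1,2) pos(1,2,3) e_pos p S(3)])
  qed (use e_pos S in auto)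
  \<comment> \<open>As \<open>c ^ 0 = 1\<close>, the divisor \<open>2 * exp 1\<close> makes a gap
    below \<open>2 * e 0\<close> sufficient for \<epsilon>-optimality.\<close>
  have e0: "2 * e 0 = \<epsilon>" by (simp add: e_def a_def)
  have mono: "e k \<le> e (Suc k)" for k
    using a c by (simp add: e_def power_increasing[of k "Suc k" c])
  \<comment> \<open>\<open>Y\<close> is \<open>\<Delta> / (2 * a)\<close>, so comparing
    \<open>\<Delta>\<close> with \<open>2 * e k\<close> amounts to comparing \<open>Y\<close> with
    \<open>exp (c ^ k)\<close>.\<close>
  define Y where "Y = exp 1 * \<Delta> / \<epsilon>"
  obtain n where "ln Y < c ^ n"
    using real_arch_pow c(1) by blast
  have Y: "0 < Y" using \<Delta>(2) pos by (simp add: Y_def)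
  have aY: "2 * (a * Y) = \<Delta>" using pos by (simp add: a_def Y_def)
  define m where "m = (LEAST k. \<Delta> < 2 * e k)"
  have iff: "\<Delta> < 2 * e k \<longleftrightarrow> Y < exp (c ^ k)" for k
    unfolding e_def aY[symmetric] using a by simp
  have "\<Delta> < 2 * e n"
    using \<open>ln Y < c ^ n\<close> Y unfolding iff by (metis exp_less_mono exp_ln)
  then have m: "\<Delta> < 2 * e m"
    unfolding m_def by (rule LeastI)
  have below: "exp (c ^ k) \<le> Y" if "k < m" for k
    using not_less_Least[of k "\<lambda>k. \<Delta> < 2 * e k"] that unfolding m_def iff by simp
  obtain t where t: "f (best (\<sigma> t)) - min_value S f < 2 * e 0"
    "real t \<le> (\<Sum>j<m. 4 * (e (Suc j) / e j) * real (T j))"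
    using reach[OF T_pos mono, of m] m \<Delta>(1) by auto
  define R where "R = sqrt (\<alpha> * \<beta>) / \<mu> powr (1 / p)"
  have R: "0 \<le> R" using pos by (simp add: R_def)
  have T_le: "real (T k) \<le> 10 * R * e k powr - (1 - 1 / p) + 1" for k
  proof -
    have "real (T k) \<le> 10 * iteration_rate p \<alpha> \<beta> \<mu> (e k) + 1"
      using iteration_rate_pos[of \<alpha> \<beta> \<mu> "e k" p] pos e_pos[of k] unfolding T_def by linarith
    then show ?thesis by (simp add: iteration_rate_powr R_def)
  qed
  have "(\<Sum>j<m. 4 * (e (Suc j) / e j) * real (T j))
      \<le> 4 * (10 * R) * a powr - (1 - 1 / p) * exp_power_sum (1 + (1 - 1 / p) - c) c
        + 4 * Y powr r * exp_power_sum (1 + r - c) c"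
    unfolding e_def using c a R below T_le
    by (intro stage_sum_bound) (auto simp: e_def)
  also have "\<dots> \<le> ?b"
  proof -
    \<comment> \<open>Passing from \<open>a\<close> to \<open>\<epsilon>\<close> costs a factor of
      at most 6, which yields the constant \<open>240 = 4 * 10 * 6\<close>.\<close>
    have "(2 * exp 1 :: real) powr (1 - 1 / p) \<le> (2 * exp 1) powr 1"
      using p exp_ge_add_one_self[of 1] by (intro powr_mono) auto
    then have "(2 * exp 1 :: real) powr (1 - 1 / p) \<le> 6"
      using exp_le by simp
    moreover have "a powr - (1 - 1 / p) = \<epsilon> powr - (1 - 1 / p) * (2 * exp 1) powr (1 - 1 / p)"
      unfolding a_def using pos powr_divide[of \<epsilon> "2 * exp 1" "- (1 - 1 / p)"]
      by (simp only: powr_minus) (simp add: field_simps)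
    ultimately have "a powr - (1 - 1 / p) \<le> \<epsilon> powr - (1 - 1 / p) * 6"
      by (simp add: mult_left_mono)
    then have "R * a powr - (1 - 1 / p) \<le> R * (\<epsilon> powr - (1 - 1 / p) * 6)"
      using R by (intro mult_left_mono)
    then have "R * a powr - (1 - 1 / p) \<le> 6 * iteration_rate p \<alpha> \<beta> \<mu> \<epsilon>"
      by (simp only: iteration_rate_powr mult_ac flip: R_def)
    then have "R * a powr - (1 - 1 / p) * exp_power_sum (2 - 1 / p - c) c
        \<le> 6 * iteration_rate p \<alpha> \<beta> \<mu> \<epsilon> * exp_power_sum (2 - 1 / p - c) c"
      using c by (intro mult_right_mono exp_power_sum_nonneg) auto
    then show ?thesis
      by (simp add: Y_def algebra_simps)
  qed
  finally show "\<exists>t. eps_optimal S f \<epsilon> (best (\<sigma> t)) \<and> real t \<le> ?b"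
    using t e0 by (intro exI[of _ t]) (auto simp: eps_optimal_def)
  define x where "x = ln (ln (2 * Y)) / ln c"
  have "exp 1 < Y" using \<Delta>(2) pos by (simp add: Y_def field_simps)
  then have "exp 1 \<le> 2 * Y" using Y by simp
  then have lnY: "1 \<le> ln (2 * Y)" using Y by (metis ln_exp ln_mono exp_gt_zero)
  then have x: "0 \<le> x" using c(1) by (simp add: x_def)
  \<comment> \<open>An index whose target exceeds \<open>\<Delta>\<close>. Rounding up, the extra
    one for strictness and the one from \<open>procs_le\<close> make up the summand 3.\<close>
  define M where "M = nat \<lceil>x\<rceil> + 1"
  have "x < real M" unfolding M_def by linarith
  then have "ln (ln (2 * Y)) < real M * ln c"
    using c(1) by (simp add: x_def field_simps)
  then have "exp (ln (ln (2 * Y))) < exp (real M * ln c)" by simp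
  then have "ln (2 * Y) < c ^ M"
    using lnY c(1) by (simp add: exp_of_nat_mult)
  then have "exp (ln (2 * Y)) < exp (c ^ M)" by simp
  then have "2 * Y < exp (c ^ M)" using Y by simp
  then have "a * (2 * Y) < e M" using a by (simp add: e_def)
  then have "\<Delta> < e M" using aY by simp
  then have "n_procs (\<sigma> s) \<le> M + 1"
    using procs_le[of M s] \<Delta>(1) by simp
  moreover have "real (M + 1) \<le> x + 3" using x unfolding M_def by linarith
  ultimately show "real (n_procs (\<sigma> s)) \<le> ln (ln (2 * exp 1 * \<Delta> / \<epsilon>)) / ln c + 3"
    by (simp add: x_def Y_def mult.assoc)
qed

text \<open>After division by \<open>\<epsilon> powr - q\<close> the left side is a multiple of
  \<open>\<epsilon> powr (q - r)\<close>, which tends to 0.\<close>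

lemma eventually_lower_order:
  fixes D q r K A :: real
  assumes "r < q" "0 < K" "0 < D"
  shows "\<forall>\<^sub>F \<epsilon> in at_right 0. A * (D / \<epsilon>) powr r \<le> K * \<epsilon> powr - q"
proof -
  have "((\<lambda>\<epsilon>::real. A * D powr r * \<epsilon> powr (q - r)) \<longlongrightarrow> A * D powr r * 0) (at_right 0)"
    using assms by (intro tendsto_mult tendsto_const) real_asymp
  then have "\<forall>\<^sub>F \<epsilon> in at_right 0. A * D powr r * \<epsilon> powr (q - r) < K"
    using assms by (intro order_tendstoD) auto
  moreover have "\<forall>\<^sub>F \<epsilon> in at_right (0::real). 0 < \<epsilon>"
    by (simp add: eventually_at_right_less)
  ultimately show ?thesis
  proof eventually_elim
    case (elim \<epsilon>)
    then have "A * D powr r * \<epsilon> powr (q - r) * \<epsilon> powr - q \<le> K * \<epsilon> powr - q"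
      by (intro mult_right_mono) auto
    also have "A * D powr r * \<epsilon> powr (q - r) * \<epsilon> powr - q = A * (D / \<epsilon>) powr r"
      using elim assms by (simp add: powr_divide powr_diff powr_minus field_simps)
    finally show ?case .
  qed
qed

text \<open>A constant factor under the double logarithm changes it by a vanishing amount, so the
  factor 2 is ample.\<close>

lemma eventually_ln_ln_le:
  fixes D A :: real
  assumes "0 < D" "0 < A"
  shows "\<forall>\<^sub>F \<epsilon> in at_right 0. ln (ln (A * D / \<epsilon>)) \<le> 2 * ln (ln (D / \<epsilon>))"
    and "\<forall>\<^sub>F \<epsilon> in at_right 0. ln (ln (D / \<epsilon>)) \<le> 2 * ln (ln (A * D / \<epsilon>))"
    and "\<forall>\<^sub>F \<epsilon> in at_right 0. 1 \<le> ln (ln (D / \<epsilon>))"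
  using assms by real_asymp+

section \<open>Lower bounds over target sequences\<close>

text \<open>With decrease \<open>2 * x\<close> the denominator is half the square of
  \<open>x\<close>, so a stage costs a fixed multiple of the iteration rate at its target.\<close>

lemma K_dec_stage:
  assumes "0 < \<alpha>" "0 < \<beta>" "0 < \<mu>" "0 < x"
  shows "K_dec \<alpha> \<beta> x (2 * x) ((2 * x / \<mu>) powr (1 / p)) =
    sqrt 32 * 2 powr (1 / p) * iteration_rate p \<alpha> \<beta> \<mu> x"
proof -
  have "16 * \<alpha> * \<beta> * ((2 * x / \<mu>) powr (1 / p))\<^sup>2 / (x * (2 * x - 3 / 2 * x))
      = 32 * (\<alpha> * \<beta>) * (((2 * x / \<mu>) powr (1 / p)) / x)\<^sup>2"
    using assms by (simp add: field_simps power2_eq_square)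
  then have "K_dec \<alpha> \<beta> x (2 * x) ((2 * x / \<mu>) powr (1 / p))
      = sqrt 32 * sqrt (\<alpha> * \<beta>) * (((2 * x / \<mu>) powr (1 / p)) / x)"
    using assms by (simp add: K_dec_def real_sqrt_mult)
  moreover have "((2 * x / \<mu>) powr (1 / p)) / x = 2 powr (1 / p) * x powr - (1 - 1 / p) / \<mu> powr (1 / p)"
    using assms by (simp add: powr_mult powr_divide powr_diff)
  ultimately show ?thesis
    by (simp add: iteration_rate_powr)
qed

lemma iteration_rate_antimono:
  assumes "0 < \<alpha>" "0 < \<beta>" "0 < \<mu>" "0 < x" "x \<le> y" "1 \<le> p"
  shows "iteration_rate p \<alpha> \<beta> \<mu> y \<le> iteration_rate p \<alpha> \<beta> \<mu> x"
  unfolding iteration_rate_powr using assms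
  by (intro mult_left_mono powr_mono2') auto

text \<open>All summands are nonnegative, so the sum dominates each one; constant factors of at
  least 1 are dropped.\<close>

lemma B_bound_term_le:
  assumes pos: "0 < \<alpha>" "0 < \<beta>" "0 < \<mu>" "0 \<le> p" and e: "\<And>k. 0 < e k"
    and k: "k < stage_count \<Delta> e"
  shows "e (Suc k) / e k * iteration_rate p \<alpha> \<beta> \<mu> (e k) \<le> B_bound p \<alpha> \<beta> \<mu> \<Delta> e"
proof -
  define t where "t k = (1 + 2 * e (k + 1) / e k) *
    K_dec \<alpha> \<beta> (e k) (2 * e k) ((2 * e k / \<mu>) powr (1 / p))" for k
  have t: "0 \<le> e (Suc k) / e k * iteration_rate p \<alpha> \<beta> \<mu> (e k) \<and>
    e (Suc k) / e k * iteration_rate p \<alpha> \<beta> \<mu> (e k) \<le> t k" for k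
  proof -
    have rate: "0 < iteration_rate p \<alpha> \<beta> \<mu> (e k)" and ratio: "0 < e (Suc k) / e k"
      using assms e by (auto intro: iteration_rate_pos)
    have "(1::real) * 1 \<le> sqrt 32 * 2 powr (1 / p)"
      using pos by (intro mult_mono ge_one_powr_ge_zero) auto
    then have "1 * iteration_rate p \<alpha> \<beta> \<mu> (e k)
        \<le> sqrt 32 * 2 powr (1 / p) * iteration_rate p \<alpha> \<beta> \<mu> (e k)"
      using rate by (intro mult_right_mono) auto
    then have "iteration_rate p \<alpha> \<beta> \<mu> (e k) \<le> K_dec \<alpha> \<beta> (e k) (2 * e k) ((2 * e k / \<mu>) powr (1 / p))"
      using K_dec_stage[OF pos(1-3) e] by simp
    moreover have "e (Suc k) / e k \<le> 1 + 2 * e (k + 1) / e k"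
      using ratio by simp
    ultimately have "e (Suc k) / e k * iteration_rate p \<alpha> \<beta> \<mu> (e k) \<le> t k"
      using rate ratio unfolding t_def by (intro mult_mono) linarith+
    then show ?thesis
      using mult_pos_pos[OF ratio rate] by simp
  qed
  then have "0 \<le> t k" for k by (meson order_trans)
  then have "t k \<le> (\<Sum>k<stage_count \<Delta> e. t k)"
    using k by (intro member_le_sum) auto
  then show ?thesis
    using t[of k] by (simp add: B_bound_def t_def)
qed

lemma stage_count_attained:
  assumes "filterlim e at_top sequentially"
  shows "\<Delta> / 2 \<le> e (stage_count \<Delta> e)"
proof -
  have "\<forall>\<^sub>F k in sequentially. \<Delta> / 2 \<le> e k"
    using assms unfolding filterlim_at_top by blast
  then obtain k where "\<Delta> / 2 \<le> e k"
    by (meson eventually_sequentially order_refl)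
  then show ?thesis
    using Inf_nat_def1[of "{k. \<Delta> / 2 \<le> e k}"] unfolding stage_count_def by blast
qed

lemma stage_count_le_top_index:
  assumes "filterlim e at_top sequentially" "0 < \<Delta>"
  shows "stage_count \<Delta> e \<le> top_index \<Delta> e"
proof -
  obtain k where "\<Delta> < e k"
    using assms by (auto simp: filterlim_at_top_dense eventually_sequentially)
  then have "top_index \<Delta> e \<in> {k. \<Delta> < e k}"
    unfolding top_index_def by (intro Inf_nat_def1) blast
  then have "\<Delta> / 2 \<le> e (top_index \<Delta> e)"
    using \<open>0 < \<Delta>\<close> by simp
  then show ?thesis
    unfolding stage_count_def by (simp add: cInf_lower)
qed

lemma stage_count_pos:
  assumes "e \<in> target_sequences \<epsilon>" "\<epsilon> < \<Delta>"
  shows "0 < stage_count \<Delta> e"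
proof (rule ccontr)
  assume "\<not> ?thesis"
  then show False
    using stage_count_attained[of e \<Delta>] assms by (auto simp: target_sequences_def)
qed

text \<open>A lower bound passes to the infimum by \<open>cINF_greatest\<close> only over a nonempty
  index set.\<close>

lemma target_sequences_nonempty:
  assumes "0 < \<epsilon>"
  shows "target_sequences \<epsilon> \<noteq> {}"
proof -
  have "(\<lambda>k. \<epsilon> / 2 * real (Suc k)) \<in> target_sequences \<epsilon>"
    unfolding target_sequences_def
  proof (intro CollectI conjI allI)
    show "filterlim (\<lambda>k. \<epsilon> / 2 * real (Suc k)) at_top sequentially"
      using assms by real_asymp
  qed (use assms in \<open>auto simp: strict_mono_def\<close>)
  then show ?thesis by blast
qed

text \<open>Stage 0 alone suffices: its ratio exceeds 1, its target is below
  \<open>\<epsilon>\<close>, and the rate decreases in the target.\<close>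

lemma B_bound_ge_iteration_rate:
  assumes pos: "0 < \<alpha>" "0 < \<beta>" "0 < \<mu>" "1 \<le> p" and e: "e \<in> target_sequences \<epsilon>"
    and \<epsilon>: "0 < \<epsilon>" "\<epsilon> < \<Delta>"
  shows "iteration_rate p \<alpha> \<beta> \<mu> \<epsilon> \<le> B_bound p \<alpha> \<beta> \<mu> \<Delta> e"
proof -
  have e': "\<And>k. 0 < e k" "e 0 < e 1" "e 0 \<le> \<epsilon> / 2"
    using e by (auto simp: target_sequences_def strict_mono_def)
  have "iteration_rate p \<alpha> \<beta> \<mu> \<epsilon> \<le> iteration_rate p \<alpha> \<beta> \<mu> (e 0)"
    using e' \<epsilon> pos by (intro iteration_rate_antimono) auto
  also have "\<dots> \<le> e (Suc 0) / e 0 * iteration_rate p \<alpha> \<beta> \<mu> (e 0)"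
    using e'(2) e'(1)[of 0] iteration_rate_pos[of \<alpha> \<beta> \<mu> "e 0" p] pos
      mult_right_mono[of 1 "e (Suc 0) / e 0" "iteration_rate p \<alpha> \<beta> \<mu> (e 0)"] by simp
  also have "\<dots> \<le> B_bound p \<alpha> \<beta> \<mu> \<Delta> e"
    using stage_count_pos[OF e \<epsilon>(2)] pos e' by (intro B_bound_term_le) auto
  finally show ?thesis .
qed

text \<open>With \<open>M\<close> the ratio of \<open>B_bound\<close> to the iteration rate, each term of the sum gives
  \<open>e (Suc k) / \<epsilon> \<le> M * (e k / \<epsilon>) powr (2 - 1 / p)\<close>.  So \<open>ln (e k / \<epsilon>)\<close> grows at most
  geometrically, and reaching \<open>\<Delta> / 2\<close> takes about \<open>ln (ln (\<Delta> / \<epsilon>)) - ln (ln M)\<close> stages.\<close>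

lemma top_index_B_bound_ge:
  assumes pos: "0 < \<alpha>" "0 < \<beta>" "0 < \<mu>" and p: "2 \<le> p" and e: "e \<in> target_sequences \<epsilon>"
    and \<epsilon>: "0 < \<epsilon>" "2 * \<epsilon> < \<Delta>"
  shows "iteration_rate p \<alpha> \<beta> \<mu> \<epsilon> * ln (ln (1 / 2 * \<Delta> / \<epsilon>)) / 2
    \<le> (real (top_index \<Delta> e) + 1) * B_bound p \<alpha> \<beta> \<mu> \<Delta> e"
proof -
  define B where "B = B_bound p \<alpha> \<beta> \<mu> \<Delta> e"
  define R where "R = iteration_rate p \<alpha> \<beta> \<mu> \<epsilon>"
  define M where "M = B / R"
  define q where "q = 1 - 1 / p"
  define m where "m = stage_count \<Delta> e"
  define u where "u k = e k / \<epsilon>" for k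
  have q: "1 / 2 \<le> q" "q \<le> 1" using p by (auto simp: q_def field_simps)
  have e': "\<And>k. 0 < e k" "e 0 < e 1" "e 0 \<le> \<epsilon> / 2" "filterlim e at_top sequentially"
    using e by (auto simp: target_sequences_def strict_mono_def)
  have R: "0 < R" using pos \<epsilon> by (simp add: R_def iteration_rate_pos)
  have u: "0 < u k" for k using e' \<epsilon> by (simp add: u_def)
  have growth: "u (Suc k) / u k * u k powr - q \<le> M" if "k < m" for k
  proof -
    have "e k powr - q = \<epsilon> powr - q * u k powr - q"
      using \<epsilon> e'(1)[of k] u[of k] by (simp add: u_def flip: powr_mult)
    then have "iteration_rate p \<alpha> \<beta> \<mu> (e k) = R * u k powr - q"
      by (simp add: R_def iteration_rate_powr q_def)
    moreover have "e (Suc k) / e k = u (Suc k) / u k"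
      using \<epsilon> by (simp add: u_def)
    ultimately have "u (Suc k) / u k * (R * u k powr - q) \<le> B"
      using B_bound_term_le[of \<alpha> \<beta> \<mu> p e k \<Delta>] that pos p e'(1) by (simp add: B_def m_def)
    then show ?thesis
      using R by (simp add: M_def field_simps)
  qed
  \<comment> \<open>Makes \<open>ln M\<close> positive, so that \<open>ln (ln M)\<close> can be used
    below.\<close>
  have M: "1 < M"
  proof -
    have u0: "u 0 \<le> 1 / 2" using e'(3) \<epsilon> by (simp add: u_def field_simps)
    have "1 < u 1 / u 0" using e'(2) e'(1)[of 0] \<epsilon> by (simp add: u_def field_simps)
    moreover have "1 powr - q \<le> u 0 powr - q"
      using u0 u[of 0] q by (intro powr_mono2') auto
    ultimately have "1 * 1 < u 1 / u 0 * u 0 powr - q"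
      by (intro mult_less_le_imp_less) auto
    then show ?thesis
      using growth[of 0] stage_count_pos[OF e, of \<Delta>] \<epsilon> by (simp add: m_def)
  qed
  \<comment> \<open>\<open>- ln M / q\<close> is the fixed point of the recursion
    \<open>x \<mapsto> ln M + (1 + q) * x\<close>; shifting by it leaves a purely geometric
    one.\<close>
  have "ln (u k) + ln M / q \<le> (1 + q) ^ k * (ln M / q)" if "k \<le> m" for k
    using that
  proof (induction k)
    case 0
    have "u 0 \<le> 1" using e'(3) \<epsilon> by (simp add: u_def)
    then show ?case using u[of 0] by (simp add: ln_le_zero_iff)
  next
    case (Suc k)
    have "ln (u (Suc k) / u k * u k powr - q) \<le> ln M"
      using growth[of k] Suc.prems u[of k] u[of "Suc k"] by (intro ln_mono) (auto intro!: divide_pos_pos mult_pos_pos)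
    then have "ln (u (Suc k)) \<le> ln M + (1 + q) * ln (u k)"
      using u[of k] u[of "Suc k"] by (simp add: ln_mult ln_div ln_powr algebra_simps)
    moreover have "(1 + q) * (ln M / q) = ln M + ln M / q"
      using q by (simp add: field_simps)
    ultimately have "ln (u (Suc k)) + ln M / q \<le> (1 + q) * (ln (u k) + ln M / q)"
      by (simp only: distrib_left)
    also have "\<dots> \<le> (1 + q) * ((1 + q) ^ k * (ln M / q))"
      using Suc q by (intro mult_left_mono) auto
    finally show ?case by (simp add: mult_ac)
  qed
  then have "ln (u m) + ln M / q \<le> (1 + q) ^ m * (ln M / q)" by blast
  moreover have "(1 + q) ^ m * (ln M / q) \<le> 2 ^ m * (2 * ln M)"
    using q M by (intro mult_mono power_mono) (auto simp: field_simps)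
  moreover have "0 < ln M / q" using q M by simp
  moreover have "ln (1 / 2 * \<Delta> / \<epsilon>) \<le> ln (u m)"
    using stage_count_attained[OF e'(4), of \<Delta>] \<epsilon>
    by (intro ln_mono) (auto simp: u_def m_def field_simps)
  ultimately have "ln (1 / 2 * \<Delta> / \<epsilon>) \<le> 2 ^ m * (2 * ln M)" by linarith
  moreover have "0 < ln (1 / 2 * \<Delta> / \<epsilon>)" using \<epsilon> by simp
  ultimately have "ln (ln (1 / 2 * \<Delta> / \<epsilon>)) \<le> ln (2 ^ m * (2 * ln M))"
    by (intro ln_mono) auto
  also have "\<dots> = real m * ln 2 + ln 2 + ln (ln M)"
    using M by (simp add: ln_mult ln_realpow)
  also have "\<dots> \<le> real m + 1 + M"
  proof -
    have "real m * ln 2 \<le> real m * 1"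
      using ln_2_less_1 by (intro mult_left_mono) auto
    moreover have "ln (ln M) \<le> ln M - 1" "ln M \<le> M - 1"
      using M by (auto intro: ln_le_minus_one)
    ultimately show ?thesis using ln_2_less_1 by linarith
  qed
  \<comment> \<open>Both factors are at least 1, so their sum is at most twice their product, the
    quantity to be bounded below.\<close>
  also have "\<dots> \<le> 2 * ((real m + 1) * M)"
  proof -
    have "(real m + 1) * 1 \<le> (real m + 1) * M" "1 * M \<le> (real m + 1) * M"
      using M by (intro mult_mono; simp)+
    from add_mono[OF this] show ?thesis by (simp only: mult_1 mult_1_right mult_2)
  qed
  finally have "R * ln (ln (1 / 2 * \<Delta> / \<epsilon>)) \<le> R * (2 * ((real m + 1) * M))"
    using R by (intro mult_left_mono) auto
  then have "R * ln (ln (1 / 2 * \<Delta> / \<epsilon>)) / 2 \<le> (real m + 1) * B"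
    using R by (simp add: M_def)
  also have "\<dots> \<le> (real (top_index \<Delta> e) + 1) * B"
  proof (intro mult_right_mono)
    show "real m + 1 \<le> real (top_index \<Delta> e) + 1"
      using stage_count_le_top_index[OF e'(4), of \<Delta>] \<epsilon> by (simp add: m_def)
    show "0 \<le> B" using M R by (simp add: M_def field_simps)
  qed
  finally show ?thesis by (simp add: R_def B_def)
qed

theorem corollary4p5:
  fixes p :: real
  assumes p: "p \<ge> 2"
  shows
    "(\<forall>c::real. 1 < c \<and> c < 2 - 1 / p \<longrightarrow>
       (\<exists>C>0. \<forall>\<alpha>>0. \<forall>\<beta>>0. \<forall>\<mu>>0. \<forall>\<Delta>\<^sub>0>0. \<forall>\<^sub>F \<epsilon> in at_right 0.
          \<forall>(S :: 'a::real_inner set) f F x0 \<sigma>.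
            (\<exists>B. finite B \<and> S = span B) \<and>
            convex_on S f \<and> minimizers S f \<noteq> {} \<and>
            smoothing_family S f \<alpha> \<beta> F \<and>
            x0 \<in> S \<and>
            (\<forall>x\<in>S. f x \<le> f x0 \<longrightarrow>
               f x - min_value S f \<ge> \<mu> * infdist x (minimizers S f) powr p) \<and>
            \<Delta>\<^sub>0 = f x0 - min_value S f \<and> 0 < \<epsilon> \<and> \<epsilon> < \<Delta>\<^sub>0 \<and>
            scheme_run f (smoothing_step S \<alpha> \<beta> F) (\<lambda>k. \<epsilon> / (2 * exp 1) * exp (c ^ k)) 1 x0 \<sigma>
          \<longrightarrow>
            (\<exists>t. eps_optimal S f \<epsilon> (best (\<sigma> t))) \<and>
            real (iteration_complexity S f \<epsilon> \<sigma>) \<le> C * iteration_rate p \<alpha> \<beta> \<mu> \<epsilon> \<and>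
            real (oracle_complexity S f \<epsilon> \<sigma>) \<le> C * oracle_rate p \<alpha> \<beta> \<mu> \<Delta>\<^sub>0 \<epsilon>)) \<and>
     (\<exists>C>0. \<forall>\<alpha>>0. \<forall>\<beta>>0. \<forall>\<mu>>0. \<forall>\<Delta>\<^sub>0>0. \<forall>\<^sub>F \<epsilon> in at_right 0.
        (INF e\<in>target_sequences \<epsilon>. B_bound p \<alpha> \<beta> \<mu> \<Delta>\<^sub>0 e) \<ge> C * iteration_rate p \<alpha> \<beta> \<mu> \<epsilon> \<and>
        (INF e\<in>target_sequences \<epsilon>. (real (top_index \<Delta>\<^sub>0 e) + 1) * B_bound p \<alpha> \<beta> \<mu> \<Delta>\<^sub>0 e)
          \<ge> C * oracle_rate p \<alpha> \<beta> \<mu> \<Delta>\<^sub>0 \<epsilon>)"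
    (is "(\<forall>c. _ c \<longrightarrow> (\<exists>C>0. \<forall>\<alpha>>0. \<forall>\<beta>>0. \<forall>\<mu>>0. \<forall>\<Delta>\<^sub>0>0. ?upper c C \<alpha> \<beta> \<mu> \<Delta>\<^sub>0)) \<and>
      (\<exists>C>0. \<forall>\<alpha>>0. \<forall>\<beta>>0. \<forall>\<mu>>0. \<forall>\<Delta>\<^sub>0>0. ?lower C \<alpha> \<beta> \<mu> \<Delta>\<^sub>0)")
proof (rule conjI)

  \<comment> \<open>Upper bounds for the scheme\<close>
  show "\<forall>c::real. 1 < c \<and> c < 2 - 1 / p \<longrightarrow> (\<exists>C>0. \<forall>\<alpha>>0. \<forall>\<beta>>0. \<forall>\<mu>>0. \<forall>\<Delta>\<^sub>0>0. ?upper c C \<alpha> \<beta> \<mu> \<Delta>\<^sub>0)"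
  proof (intro allI impI, elim conjE)
    fix c :: real assume c: "1 < c" "c < 2 - 1 / p"
    define G where "G = exp_power_sum (2 - 1 / p - c) c"
    \<comment> \<open>The added 1 absorbs the lower-order term, which is eventually at most one
      iteration rate.\<close>
    define C\<^sub>1 where "C\<^sub>1 = 240 * G + 1"
    define C where "C = C\<^sub>1 * (2 / ln c + 3)"
    define r where "r = (c - 1 + (1 - 1 / p)) / 2"
    have "0 \<le> G" using c by (auto simp: G_def intro: exp_power_sum_nonneg)
    then have C1: "0 < C\<^sub>1" by (simp add: C\<^sub>1_def)
    have lnc: "0 < ln c" using c by simp
    have C: "0 < C" "C\<^sub>1 \<le> C"
      unfolding C_def using C1 lnc by (auto simp: mult_le_cancel_left1 add_pos_pos)
    have r: "c - 1 < r" "r < 1 - 1 / p" using c by (auto simp: r_def field_simps)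
    have "?upper c C \<alpha> \<beta> \<mu> \<Delta>"
      if pos: "0 < \<alpha>" "0 < \<beta>" "0 < \<mu>" "0 < \<Delta>" for \<alpha> \<beta> \<mu> \<Delta>
    proof -
      \<comment> \<open>The three asymptotic conditions involve only the numerical parameters, so
        the threshold for \<epsilon> is uniform over \<open>S\<close>, \<open>f\<close>,
        \<open>F\<close>, \<open>x0\<close> and the runs.\<close>
      have "\<forall>\<^sub>F \<epsilon> in at_right 0. 4 * exp_power_sum (1 + r - c) c * (exp 1 * \<Delta> / \<epsilon>) powr r
          \<le> sqrt (\<alpha> * \<beta>) / \<mu> powr (1 / p) * \<epsilon> powr - (1 - 1 / p)"
        using r(2) pos by (intro eventually_lower_order) auto
      moreover have "\<forall>\<^sub>F \<epsilon> in at_right 0. ln (ln ((2 * exp 1) * \<Delta> / \<epsilon>)) \<le> 2 * ln (ln (\<Delta> / \<epsilon>))"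
        using pos by (intro eventually_ln_ln_le) auto
      moreover have "\<forall>\<^sub>F \<epsilon> in at_right 0. 1 \<le> ln (ln (\<Delta> / \<epsilon>))"
        using pos(4) zero_less_one by (rule eventually_ln_ln_le)
      ultimately show ?thesis
      proof eventually_elim
        case (elim \<epsilon>)
        show ?case
        proof (intro allI impI, elim conjE exE)
          fix S :: "'a set" and f F x0 \<sigma> B
          assume H: "S = span B" "minimizers S f \<noteq> {}" "smoothing_family S f \<alpha> \<beta> F" "x0 \<in> S"
            "\<forall>x\<in>S. f x \<le> f x0 \<longrightarrow> f x - min_value S f \<ge> \<mu> * infdist x (minimizers S f) powr p"
            "\<Delta> = f x0 - min_value S f" "0 < \<epsilon>" "\<epsilon> < \<Delta>"
            "scheme_run f (smoothing_step S \<alpha> \<beta> F) (\<lambda>k. \<epsilon> / (2 * exp 1) * exp (c ^ k)) 1 x0 \<sigma>"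
          have S: "subspace S" using H(1) by (simp add: subspace_span)
          note complexity = scheme_complexity[OF S H(3,2,4) _ pos(1-3) H(7) p c r(1) H(6,8,9)]
          define R where "R = iteration_rate p \<alpha> \<beta> \<mu> \<epsilon>"
          define l where "l = ln (ln (\<Delta> / \<epsilon>))"
          have R: "0 < R" using pos H(7) by (simp add: R_def iteration_rate_pos)
          have l: "1 \<le> l" using elim(3) by (simp add: l_def)
          obtain t where t: "eps_optimal S f \<epsilon> (best (\<sigma> t))"
            "real t \<le> 240 * G * R + 4 * (exp 1 * \<Delta> / \<epsilon>) powr r * exp_power_sum (1 + r - c) c"
            using complexity(1) H(5) unfolding G_def R_def by blast
          define n where "n = iteration_complexity S f \<epsilon> \<sigma>"
          have "n \<le> t"
            unfolding n_def iteration_complexity_def using t(1) by (rule Least_le)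
          moreover have "4 * exp_power_sum (1 + r - c) c * (exp 1 * \<Delta> / \<epsilon>) powr r \<le> R"
            using elim(1) by (simp only: R_def iteration_rate_powr)
          ultimately have n: "real n \<le> C\<^sub>1 * R"
            using t(2) by (simp add: C\<^sub>1_def algebra_simps)
          have procs: "real (n_procs (\<sigma> s)) \<le> (2 / ln c + 3) * l" for s
          proof -
            have "real (n_procs (\<sigma> s)) \<le> ln (ln (2 * exp 1 * \<Delta> / \<epsilon>)) / ln c + 3"
              using complexity(2) H(5) by blast
            also have "\<dots> \<le> 2 * l / ln c + 3 * l"
              using elim(2) lnc l by (intro add_mono divide_right_mono) (auto simp: l_def)
            finally show ?thesis by (simp add: algebra_simps)
          qed
          have "real (oracle_complexity S f \<epsilon> \<sigma>) = (\<Sum>s<n. real (n_procs (\<sigma> s)))"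
            by (simp add: oracle_complexity_def n_def)
          also have "\<dots> \<le> real n * ((2 / ln c + 3) * l)"
            using sum_bounded_above[of "{..<n}" "\<lambda>s. real (n_procs (\<sigma> s))"] procs by simp
          also have "\<dots> \<le> C\<^sub>1 * R * ((2 / ln c + 3) * l)"
            using n lnc l by (intro mult_right_mono) auto
          also have "\<dots> = C * oracle_rate p \<alpha> \<beta> \<mu> \<Delta> \<epsilon>"
            by (simp add: C_def oracle_rate_def R_def l_def mult_ac)
          finally have "real (oracle_complexity S f \<epsilon> \<sigma>) \<le> C * oracle_rate p \<alpha> \<beta> \<mu> \<Delta> \<epsilon>" .
          moreover have "real n \<le> C * R"
            using n mult_right_mono[OF C(2), of R] R by linarith
          ultimately show "(\<exists>t. eps_optimal S f \<epsilon> (best (\<sigma> t))) \<and>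
              real (iteration_complexity S f \<epsilon> \<sigma>) \<le> C * iteration_rate p \<alpha> \<beta> \<mu> \<epsilon> \<and>
              real (oracle_complexity S f \<epsilon> \<sigma>) \<le> C * oracle_rate p \<alpha> \<beta> \<mu> \<Delta> \<epsilon>"
            using t(1) by (auto simp: n_def R_def)
        qed
      qed
    qed
    then show "\<exists>C>0. \<forall>\<alpha>>0. \<forall>\<beta>>0. \<forall>\<mu>>0. \<forall>\<Delta>\<^sub>0>0. ?upper c C \<alpha> \<beta> \<mu> \<Delta>\<^sub>0"
      using C(1) by blast
  qed

  \<comment> \<open>Lower bounds for all target sequences, with one factor 1/2 from
    \<open>top_index_B_bound_ge\<close> and one from comparing double logarithms\<close>
  have "?lower (1 / 4) \<alpha> \<beta> \<mu> \<Delta>" if pos: "0 < \<alpha>" "0 < \<beta>" "0 < \<mu>" "0 < \<Delta>" for \<alpha> \<beta> \<mu> \<Delta>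
  proof -
    have "\<forall>\<^sub>F \<epsilon> in at_right 0. \<epsilon> \<in> {0<..<\<Delta> / 2}"
      using pos by (intro eventually_at_right_real) simp
    moreover have "\<forall>\<^sub>F \<epsilon> in at_right 0. ln (ln (\<Delta> / \<epsilon>)) \<le> 2 * ln (ln (1 / 2 * \<Delta> / \<epsilon>))"
      using pos by (intro eventually_ln_ln_le) auto
    ultimately show ?thesis
    proof eventually_elim
      case (elim \<epsilon>)
      then have \<epsilon>: "0 < \<epsilon>" "2 * \<epsilon> < \<Delta>" by auto
      have R: "0 < iteration_rate p \<alpha> \<beta> \<mu> \<epsilon>"
        using pos \<epsilon> by (simp add: iteration_rate_pos)
      have rate: "1 / 4 * oracle_rate p \<alpha> \<beta> \<mu> \<Delta> \<epsilon>
          \<le> iteration_rate p \<alpha> \<beta> \<mu> \<epsilon> * ln (ln (1 / 2 * \<Delta> / \<epsilon>)) / 2"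
        using mult_left_mono[OF elim(2), of "iteration_rate p \<alpha> \<beta> \<mu> \<epsilon>"] R
        by (simp add: oracle_rate_def)
      show ?case
      proof (intro conjI cINF_greatest target_sequences_nonempty \<epsilon>(1))
        fix e assume e: "e \<in> target_sequences \<epsilon>"
        have "iteration_rate p \<alpha> \<beta> \<mu> \<epsilon> \<le> B_bound p \<alpha> \<beta> \<mu> \<Delta> e"
          using p \<epsilon> by (intro B_bound_ge_iteration_rate[OF pos(1-3) _ e]) auto
        then show "1 / 4 * iteration_rate p \<alpha> \<beta> \<mu> \<epsilon> \<le> B_bound p \<alpha> \<beta> \<mu> \<Delta> e"
          using R by linarith
        show "1 / 4 * oracle_rate p \<alpha> \<beta> \<mu> \<Delta> \<epsilon>
            \<le> (real (top_index \<Delta> e) + 1) * B_bound p \<alpha> \<beta> \<mu> \<Delta> e"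
          using rate top_index_B_bound_ge[OF pos(1-3) p e \<epsilon>] by (rule order_trans)
      qed
    qed
  qed
  then show "\<exists>C>0. \<forall>\<alpha>>0. \<forall>\<beta>>0. \<forall>\<mu>>0. \<forall>\<Delta>\<^sub>0>0. ?lower C \<alpha> \<beta> \<mu> \<Delta>\<^sub>0"
    by (intro exI[of _ "1 / 4"]) auto
qed

end
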